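(* Fix $n\ge1$. The rank functions $r_{\mathrm{SM}_n(I)}$ of the Schubert matroids, for $I$ ranging over the nonempty subsets of $[n]$, form a basis of the real vector space of functions $f\colon2^{[n]}\to\mathbb R$ satisfying $f(\emptyset)=0$. In particular: 1. A generalized permutahedron $P\subset\mathbb R^n$ is a Schubitope if and only if its associated submodular function is a $\mathbb Z_{\ge0}$-linear combination of rank functions of Schubert matroids. 2. For diagrams $D,D'\subseteq[n]\times[k]$, the Schubitopes $\mathcal S_D$ and $\mathcal S_{D'}$ are equal if and only if $D$ can be obtained from $D'$ by a permutation of columns.
   Context: Write $[n]=\{1,\dots,n\}$. Schubert matroids. For $I=\{s_1<\dots<s_r\}\subseteq[n]$, $\mathrm{SM}_n(I)$ is the matroid on ground set $[n]$ whose bases are the sets $\{a_1<\dots<a_r\}\subseteq[n]$ with $a_p\le s_p$ for all $p$. The rank function of a matroid $M$ with set of bases $\mathcal B$ is $r_M(J)=\max\{\#(J\cap B)\colon B\in\mathcal B\}$. Generalized permutahedra. A function $z\colon2^{[n]}\to\mathbb R$ is submodular if $z(I)+z(J)\ge z(I\cup J)+z(I\cap J)$ for all $I,J$. A generalized permutahedron is a polytope of the form $P=\{t\in\mathbb R^n\colon\sum_{i\in I}t_i\le z(I)\ \forall I\subseteq[n],\ \sum_{i=1}^nt_i=z([n])\}$ with $z$ submodular and $z(\emptyset)=0$; this $z$, called the associated submodular function, is determined by $P$ through $z(I)=\max\{\sum_{i\in I}p_i\colon p\in P\}$. Schubitopes. A diagram is a subset $D\subseteq[n]\times[k]$ (first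 coordinate = row, second = column) with columns $D_j=\{i\colon(i,j)\in D\}$, $j\in[k]$. For $R,S\subseteq[n]$ write $R\le S$ if $\#R=\#S$ and for every $p$ the $p$-th smallest element of $R$ is at most that of $S$; $C\le D$ means $C_j\le D_j$ for all $j$. Let $Y$ be the $n\times n$ matrix with indeterminates $y_{ij}$ for $i\le j$ and zeros elsewhere; $Y_R^S$ is the submatrix with rows $S$ and columns $R$. Let $B\subset\mathrm{GL}_n(\mathbb C)$ be the upper triangular matrices and $\mathfrak b$ the space of all upper triangular matrices; $B$ acts on $\mathbb C[\mathfrak b]=\mathbb C[y_{ij}\colon i\le j]$ by $f(Y)\cdot b=f(b^{-1}Y)$. The flagged Weyl module of $D$ is $\mathcal M_D=\mathrm{Span}_{\mathbb C}\{\prod_{j=1}^k\det(Y_{D_j}^{C_j})\colon C\le D\}$, and its dual character is the polynomial $\chi_D(x_1,\dots,x_n)=\mathrm{tr}(\mathrm{diag}(x_1^{-1},\dots,x_n^{-1})\colon\mathcal M_D\to\mathcal M_D)$. The Schubitope $\mathcal S_D\subset\mathbb R^n$ is the Newton polytope of $\chi_D$ (the convex hull of its exponent vectors). Equivalently (Fink–Mészáros–St. Dizier), $\mathcal S_D$ is the Minkowski sum $\sum_{j=1}^kP(\mathrm{SM}_n(D_j))$, where $P(M)$ is the convex hull of the 0/1 indicator vectors of the bases of $M$. *)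

theory Defs
  imports
    "HOL-Analysis.Analysis"
    "HOL-Library.Poly_Mapping"
    "HOL-Library.Function_Algebras"
    "Jordan_Normal_Form.Determinant"
begin

text \<open>
  The ground set \<open>[n]\<close> is the universe of a finite linearly ordered type \<open>'n\<close> with
  \<open>n = CARD('n) \<ge> 1\<close>, so that \<open>\<real>\<^sup>n\<close> is \<open>real ^ 'n\<close> and \<open>2^[n]\<close> is \<open>'n set\<close>.
  The column index set \<open>[k]\<close> is \<open>{1..k}\<close>.
\<close>

section \<open>Schubert matroids\<close>

definition comp_le :: "'n::linorder set \<Rightarrow> 'n set \<Rightarrow> bool" where
  "comp_le R S \<longleftrightarrow> card R = card S \<and>
     (\<forall>p < card R. sorted_list_of_set R ! p \<le> sorted_list_of_set S ! p)"

definition schubert_bases :: "'n::{finite,linorder} set \<Rightarrow> 'n set set" where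
  "schubert_bases I = {A. comp_le A I}"

definition rank_from_bases :: "'n set set \<Rightarrow> 'n set \<Rightarrow> nat" where
  "rank_from_bases \<B> J = Max ((\<lambda>B. card (J \<inter> B)) ` \<B>)"

definition schubert_rank :: "'n::{finite,linorder} set \<Rightarrow> 'n set \<Rightarrow> real" where
  "schubert_rank I J = real (rank_from_bases (schubert_bases I) J)"

definition set_fun_scale :: "real \<Rightarrow> ('n set \<Rightarrow> real) \<Rightarrow> ('n set \<Rightarrow> real)" where
  "set_fun_scale c f = (\<lambda>J. c * f J)"

definition family_basis_of ::
  "('a::field \<Rightarrow> 'b::ab_group_add \<Rightarrow> 'b) \<Rightarrow> 'i set \<Rightarrow> ('i \<Rightarrow> 'b) \<Rightarrow> 'b set \<Rightarrow> bool" where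
  "family_basis_of scl I b V \<longleftrightarrow>
     inj_on b I \<and> \<not> module.dependent scl (b ` I) \<and> module.span scl (b ` I) = V"

section \<open>Generalized permutahedra\<close>

text \<open>\<open>P\<close> is a generalized permutahedron iff \<open>associated_submodular_function P z\<close> holds for some
  \<open>z\<close>; this \<open>z\<close> is then determined by \<open>P\<close>.\<close>

definition submodular :: "('n set \<Rightarrow> real) \<Rightarrow> bool" where
  "submodular z \<longleftrightarrow> (\<forall>I J. z I + z J \<ge> z (I \<union> J) + z (I \<inter> J))"

definition associated_submodular_function :: "(real ^ 'n) set \<Rightarrow> ('n set \<Rightarrow> real) \<Rightarrow> bool" where
  "associated_submodular_function P z \<longleftrightarrow> submodular z \<and> z {} = 0 \<and>
     P = {t. (\<forall>I. (\<Sum>i\<in>I. t $ i) \<le> z I) \<and> (\<Sum>i\<in>UNIV. t $ i) = z UNIV}"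

section \<open>Multivariate polynomials\<close>

type_synonym ('v, 'a) mpoly = "('v \<Rightarrow>\<^sub>0 nat) \<Rightarrow>\<^sub>0 'a"

definition mpoly_const :: "'a::zero \<Rightarrow> ('v, 'a) mpoly" where
  "mpoly_const c = Poly_Mapping.single 0 c"

definition mpoly_var :: "'v \<Rightarrow> ('v, 'a::zero_neq_one) mpoly" where
  "mpoly_var v = Poly_Mapping.single (Poly_Mapping.single v 1) 1"

text \<open>Evaluation of a polynomial, with \<open>g\<close> substituted for the variables and the coefficients
  mapped to the target ring by \<open>\<phi>\<close>.\<close>

definition mpoly_eval :: "('a::zero \<Rightarrow> 'r::comm_semiring_1) \<Rightarrow> ('v \<Rightarrow> 'r) \<Rightarrow> ('v, 'a) mpoly \<Rightarrow> 'r" where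
  "mpoly_eval \<phi> g p = (\<Sum>m\<in>Poly_Mapping.keys p.
     \<phi> (Poly_Mapping.lookup p m) * (\<Prod>v\<in>Poly_Mapping.keys m. g v ^ Poly_Mapping.lookup m v))"

definition mpoly_scale :: "complex \<Rightarrow> ('v, complex) mpoly \<Rightarrow> ('v, complex) mpoly" where
  "mpoly_scale c p = mpoly_const c * p"

definition newton_polytope :: "('n::finite, complex) mpoly \<Rightarrow> (real ^ 'n) set" where
  "newton_polytope p =
     convex hull ((\<lambda>m. \<chi> i. real (Poly_Mapping.lookup m i)) ` Poly_Mapping.keys p)"

section \<open>Flagged Weyl modules and Schubitopes\<close>

definition is_diagram :: "nat \<Rightarrow> ('n \<times> nat) set \<Rightarrow> bool" where
  "is_diagram k D \<longleftrightarrow> D \<subseteq> UNIV \<times> {1..k}"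

definition column :: "('n \<times> nat) set \<Rightarrow> nat \<Rightarrow> 'n set" where
  "column D j = {i. (i, j) \<in> D}"

definition diagram_le :: "nat \<Rightarrow> ('n::linorder \<times> nat) set \<Rightarrow> ('n \<times> nat) set \<Rightarrow> bool" where
  "diagram_le k C D \<longleftrightarrow> (\<forall>j\<in>{1..k}. comp_le (column C j) (column D j))"

text \<open>The polynomial ring \<open>\<complex>[\<bb>] = \<complex>[y\<^sub>i\<^sub>j : i \<le> j]\<close> is regarded as a subring of the polynomial ring in
  variables indexed by all pairs; the variables with \<open>i > j\<close> never occur.\<close>

type_synonym 'n ypoly = "('n \<times> 'n, complex) mpoly"

definition generic_matrix :: "'n ypoly ^ 'n::{finite,linorder} ^ 'n::{finite,linorder}" where
  "generic_matrix = (\<chi> i j. if i \<le> j then mpoly_var (i, j) else 0)"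

text \<open>\<open>minor A R S\<close> is \<open>det (A\<^sub>R\<^sup>S)\<close>: rows \<open>S\<close>, columns \<open>R\<close>, both in increasing order,
  for \<open>card R = card S\<close>.\<close>

definition minor :: "'a::comm_ring_1 ^ 'n::{finite,linorder} ^ 'n::{finite,linorder} \<Rightarrow> 'n set \<Rightarrow> 'n set \<Rightarrow> 'a" where
  "minor A R S = Determinant.det (Matrix.mat (card S) (card R)
     (\<lambda>(p, q). A $ (sorted_list_of_set S ! p) $ (sorted_list_of_set R ! q)))"

definition flagged_weyl_module :: "nat \<Rightarrow> ('n::{finite,linorder} \<times> nat) set \<Rightarrow> 'n ypoly set" where
  "flagged_weyl_module k D = module.span mpoly_scale
     {(\<Prod>j\<in>{1..k}. minor generic_matrix (column D j) (column C j)) | C.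
        is_diagram k C \<and> diagram_le k C D}"

text \<open>The action \<open>f(Y) \<cdot> b = f(b\<^sup>-\<^sup>1 Y)\<close>, for an invertible upper triangular matrix \<open>b\<close>.\<close>

definition borel_act :: "'n ypoly \<Rightarrow> complex ^ 'n::{finite,linorder} ^ 'n::{finite,linorder} \<Rightarrow> 'n ypoly" where
  "borel_act f b = mpoly_eval mpoly_const
     (\<lambda>(i, j). (map_matrix mpoly_const (matrix_inv b) ** generic_matrix) $ i $ j) f"

definition diag_matrix :: "('n \<Rightarrow> 'a::zero) \<Rightarrow> 'a ^ 'n ^ 'n" where
  "diag_matrix x = (\<chi> i j. if i = j then x i else 0)"

text \<open>The trace of a linear endomorphism \<open>T\<close> of a finite-dimensional subspace \<open>V\<close>, with respect
  to some basis of \<open>V\<close> (the value does not depend on the basis).\<close>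

definition trace_on ::
  "('a::field \<Rightarrow> 'b::ab_group_add \<Rightarrow> 'b) \<Rightarrow> 'b set \<Rightarrow> ('b \<Rightarrow> 'b) \<Rightarrow> 'a" where
  "trace_on scl V T =
     (let B = (SOME B. \<not> module.dependent scl B \<and> module.span scl B = V)
      in \<Sum>b\<in>B. module.representation scl B (T b) b)"

text \<open>The trace of the action of \<open>diag(x\<^sub>1\<^sup>-\<^sup>1, \<dots>, x\<^sub>n\<^sup>-\<^sup>1)\<close>, as the unique polynomial inducing it as a function on the torus
  \<open>(\<complex> - {0})\<^sup>n\<close>.\<close>

definition dual_character :: "nat \<Rightarrow> ('n::{finite,linorder} \<times> nat) set \<Rightarrow> ('n, complex) mpoly" where
  "dual_character k D = (THE p. \<forall>x. (\<forall>i. x i \<noteq> 0) \<longrightarrow>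
     mpoly_eval (\<lambda>c. c) x p =
       trace_on mpoly_scale (flagged_weyl_module k D)
         (\<lambda>f. borel_act f (diag_matrix (\<lambda>i. inverse (x i)))))"

definition schubitope :: "nat \<Rightarrow> ('n::{finite,linorder} \<times> nat) set \<Rightarrow> (real ^ 'n::{finite,linorder}) set" where
  "schubitope k D = newton_polytope (dual_character k D)"

definition is_schubitope :: "(real ^ 'n::{finite,linorder}) set \<Rightarrow> bool" where
  "is_schubitope P \<longleftrightarrow> (\<exists>k D. is_diagram k D \<and> P = schubitope k D)"

end

theory Submission
  imports Defs
begin

text \<open>
  \<^bold>\<open>Rank functions.\<close> A set is independent in the Schubert matroid of \<open>I\<close> iff no upper set contains
  more of its elements than of \<open>I\<close>; hence the rank of \<open>J\<close> is the minimum of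
  \<open>#(J \<inter> L) + #(I - L)\<close> over the lower sets \<open>L\<close>. For \<open>J\<close> contained in the elements above \<open>a\<close>, adding \<open>a\<close> to \<open>J\<close>
  fails to raise the rank precisely if \<open>a \<notin> I\<close> and \<open>J\<close> dominates the part of \<open>I\<close> above \<open>a\<close>. Dominance is a
  partial order, so its zeta matrix is invertible, and the coefficients of a linear relation
  between the rank functions vanish by induction along the upper sets. Counting dimensions
  gives the basis.

  \<^bold>\<open>Schubitopes.\<close> The spanning products of minors are nonzero weight vectors, so the exponents of the
  dual character are exactly the sums of indicator vectors of the columns of the diagrams
  \<open>C \<le> D\<close>. Greedy bases maximise a linear functional over all columns at once; by separation,
  the Schubitope is the generalized permutahedron of the sum of the rank functions of
  the columns. A generalized permutahedron determines its submodular function, so both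
  claims on Schubitopes reduce to the linear independence of the rank functions.
\<close>

section \<open>Rank functions of Schubert matroids\<close>

text \<open>Indexing the sorted list is a bijection. This turns the positionwise comparison of sets
  into a comparison of cardinalities.\<close>

lemma card_Diff_nth:
  assumes "finite A"
  shows "card (A - B) = card {p. p < card A \<and> sorted_list_of_set A ! p \<notin> B}"
proof -
  let ?xs = "sorted_list_of_set A"
  have "bij_betw ((!) ?xs) {p. p < card A \<and> ?xs ! p \<notin> B} (A - B)"
    unfolding bij_betw_def
  proof
    show "inj_on ((!) ?xs) {p. p < card A \<and> ?xs ! p \<notin> B}"
      by (auto simp: inj_on_def nth_eq_iff_index_eq)
    have "x \<in> A \<Longrightarrow> \<exists>p<card A. ?xs ! p = x" for x
      using assms in_set_conv_nth[of x ?xs] by simp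
    moreover have "p < card A \<Longrightarrow> ?xs ! p \<in> A" for p
      using assms nth_mem[of p ?xs] by simp
    ultimately show "(!) ?xs ` {p. p < card A \<and> ?xs ! p \<notin> B} = A - B"
      by blast
  qed
  from bij_betw_same_card[OF this] show ?thesis by simp
qed

definition down_closed :: "'n::linorder set \<Rightarrow> bool" where
  "down_closed L \<longleftrightarrow> (\<forall>x\<in>L. \<forall>y\<le>x. y \<in> L)"

lemma down_closed_simps [simp]:
  "down_closed {}" "down_closed UNIV" "down_closed {..i}" "down_closed {..<i}"
  by (auto simp: down_closed_def)

text \<open>Upper sets are written as complements of lower sets \<open>L\<close>, the form in which
  they enter the rank formula.\<close>

definition schubert_indep :: "'n::{finite,linorder} set \<Rightarrow> 'n set \<Rightarrow> bool" where
  "schubert_indep I A \<longleftrightarrow> (\<forall>L. down_closed L \<longrightarrow> card (A - L) \<le> card (I - L))"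

lemma schubert_indep_refl: "schubert_indep I I"
  by (simp add: schubert_indep_def)

lemma schubert_indep_mono:
  fixes I :: "'n::{finite,linorder} set"
  shows "schubert_indep I A \<Longrightarrow> B \<subseteq> A \<Longrightarrow> schubert_indep I B"
  unfolding schubert_indep_def by (meson Diff_mono card_mono finite le_trans order_refl)

text \<open>Under positionwise comparison, each position of \<open>A\<close> that lies outside a
  lower set also does so for \<open>I\<close>. Conversely, a position where \<open>A\<close> exceeds
  \<open>I\<close> is detected by the lower set of all elements below that entry of
  \<open>A\<close>.\<close>

lemma schubert_bases_iff:
  fixes I :: "'n::{finite,linorder} set"
  shows "A \<in> schubert_bases I \<longleftrightarrow> card A = card I \<and> schubert_indep I A"
proof -
  let ?a = "sorted_list_of_set A" and ?s = "sorted_list_of_set I"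
  have "schubert_indep I A" if "card A = card I" "\<And>p. p < card A \<Longrightarrow> ?a ! p \<le> ?s ! p"
    unfolding schubert_indep_def
  proof (intro allI impI)
    fix L :: "'n set" assume L: "down_closed L"
    show "card (A - L) \<le> card (I - L)"
      unfolding card_Diff_nth[OF finite]
      using that L unfolding down_closed_def by (intro card_mono) auto
  qed
  moreover have "?a ! p \<le> ?s ! p" if "card A = card I" "schubert_indep I A" and p: "p < card A" for p
  proof (rule ccontr)
    assume "\<not> ?thesis"
    hence less: "?s ! p < ?a ! p" by simp
    let ?L = "{..<?a ! p}"
    \<comment> \<open>From position \<open>p\<close> on, all entries of \<open>A\<close> lie outside
      \<open>?L\<close>, whereas for \<open>I\<close> only positions after \<open>p\<close> can. The
      counts then differ by at least one, against independence.\<close>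
    have "card {p..<card A} \<le> card (A - ?L)"
      unfolding card_Diff_nth[OF finite]
      by (intro card_mono) (auto simp: not_less intro: sorted_nth_mono)
    moreover have "card (I - ?L) \<le> card {Suc p..<card I}"
      unfolding card_Diff_nth[OF finite]
    proof (intro card_mono subsetI)
      fix q assume q: "q \<in> {q. q < card I \<and> ?s ! q \<notin> ?L}"
      hence "\<not> q \<le> p" using less p \<open>card A = card I\<close> sorted_nth_mono[of ?s q p]
        by (auto simp: not_less)
      thus "q \<in> {Suc p..<card I}" using q by auto
    qed simp
    moreover have "card (A - ?L) \<le> card (I - ?L)"
      using that(2) unfolding schubert_indep_def by simp
    ultimately show False using p \<open>card A = card I\<close> by simp
  qed
  ultimately show ?thesis
    by (auto simp: schubert_bases_def comp_le_def)
qed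

lemma base_in_schubert_bases: "I \<in> schubert_bases I"
  by (simp add: schubert_bases_iff schubert_indep_refl)

lemma card_Int_base_le:
  fixes I :: "'n::{finite,linorder} set"
  assumes "schubert_indep I A" "down_closed L"
  shows "card (J \<inter> A) \<le> card (J \<inter> L) + card (I - L)"
proof -
  have "J \<inter> A \<subseteq> (J \<inter> L) \<union> (A - L)" by auto
  hence "card (J \<inter> A) \<le> card (J \<inter> L) + card (A - L)"
    by (meson card_Un_le card_mono finite le_trans)
  thus ?thesis using assms unfolding schubert_indep_def by (meson add_left_mono le_trans)
qed

text \<open>The least element \<open>x\<close> of \<open>J - B\<close> cannot be added, so some
  lower set \<open>L\<close> is violated by \<open>insert x B\<close>. This \<open>L\<close> is
  tight for \<open>B\<close> and contains nothing of \<open>J - B\<close>, hence it attains the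
  upper bound of \<open>card_Int_base_le\<close>.\<close>

lemma maximal_indep_card:
  fixes I :: "'n::{finite,linorder} set"
  assumes B: "schubert_indep I B" "B \<subseteq> J"
    and max: "\<And>x. x \<in> J - B \<Longrightarrow> \<not> schubert_indep I (insert x B)"
  shows "\<exists>L. down_closed L \<and> card B = card (J \<inter> L) + card (I - L)"
proof (cases "J = B")
  case True
  thus ?thesis by (intro exI[of _ UNIV]) simp
next
  case False
  define x where "x = Min (J - B)"
  have x: "x \<in> J - B" "\<And>y. y \<in> J - B \<Longrightarrow> x \<le> y"
    using False B Min_in[of "J - B"] by (auto simp: x_def)
  obtain L where L: "down_closed L" "card (I - L) < card (insert x B - L)"
    using max[OF x(1)] unfolding schubert_indep_def by (auto simp: not_le)
  have le: "card (B - L) \<le> card (I - L)" using B L unfolding schubert_indep_def by auto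
  \<comment> \<open>\<open>B\<close> alone satisfies the inequality at \<open>L\<close>, so
    \<open>x\<close> itself must be counted outside \<open>L\<close>.\<close>
  have xL: "x \<notin> L" using L le by (auto simp: insert_Diff_if)
  hence "card (insert x B - L) = Suc (card (B - L))" using x by (simp add: insert_Diff_if)
  hence eq: "card (B - L) = card (I - L)" using L le by simp
  have "y \<notin> L" if "y \<in> J - B" for y
    using x(2)[OF that] xL L unfolding down_closed_def by auto
  hence "B \<inter> L = J \<inter> L" using B by auto
  moreover have "card B = card (B \<inter> L) + card (B - L)"
    by (simp add: card_Int_Diff)
  ultimately show ?thesis using eq L by auto
qed

text \<open>Scan the list and keep every element that preserves independence. What \<open>B\<close>
  has in a prefix is exactly what had been kept by then, so a single \<open>B\<close> is maximal in
  all prefixes at once.\<close>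

lemma greedy_indep:
  fixes I :: "'n::{finite,linorder} set"
  shows "distinct xs \<Longrightarrow> \<exists>B. schubert_indep I B \<and> B \<subseteq> set xs \<and>
     (\<forall>k\<le>length xs. \<forall>x\<in>set (take k xs) - B. \<not> schubert_indep I (insert x (B \<inter> set (take k xs))))"
proof (induction xs rule: rev_induct)
  case Nil
  show ?case by (auto simp: schubert_indep_def)
next
  case (snoc x xs)
  then obtain B where B: "schubert_indep I B" "B \<subseteq> set xs" and max:
    "\<And>k y. k \<le> length xs \<Longrightarrow> y \<in> set (take k xs) - B \<Longrightarrow> \<not> schubert_indep I (insert y (B \<inter> set (take k xs)))"
    by auto
  have x: "x \<notin> set xs" using snoc by simp
  define B' where "B' = (if schubert_indep I (insert x B) then insert x B else B)"
  have B': "schubert_indep I B'" "B' \<subseteq> set (xs @ [x])" "B \<subseteq> B'" "B' \<inter> set xs = B"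
    using B x by (auto simp: B'_def)
  have "\<not> schubert_indep I (insert y (B' \<inter> set (take k (xs @ [x]))))"
    if k: "k \<le> length (xs @ [x])" and y: "y \<in> set (take k (xs @ [x])) - B'" for k y
  proof (cases "k \<le> length xs")
    case True
    have "set (take k xs) \<subseteq> set xs" by (rule set_take_subset)
    hence "B' \<inter> set (take k xs) = B \<inter> set (take k xs)" using B'(4) by auto
    thus ?thesis using max[OF True] y B'(3) True by auto
  next
    case False
    hence k': "take k (xs @ [x]) = xs @ [x]" using k by simp
    show ?thesis
    proof (cases "y = x")
      case True
      thus ?thesis using y B' B unfolding k' by (auto simp: B'_def Int_absorb2 split: if_splits)
    next
      case False
      have "y \<in> set xs" "y \<notin> B" using y False B'(3) unfolding k' by auto
      hence "\<not> schubert_indep I (insert y (B \<inter> set xs))"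
        using max[of "length xs" y] by simp
      thus ?thesis
        unfolding k' using B B'(3) schubert_indep_mono[of I "insert y (B' \<inter> set (xs @ [x]))" "insert y (B \<inter> set xs)"] by auto
    qed
  qed
  thus ?case using B' by blast
qed

lemma rank_from_bases_ge: "finite \<B> \<Longrightarrow> B \<in> \<B> \<Longrightarrow> card (J \<inter> B) \<le> rank_from_bases \<B> J"
  unfolding rank_from_bases_def by (rule Max_ge) auto

lemma rank_attained:
  fixes I :: "'n::{finite,linorder} set"
  shows "\<exists>A\<in>schubert_bases I. card (J \<inter> A) = rank_from_bases (schubert_bases I) J"
proof -
  have "rank_from_bases (schubert_bases I) J \<in> (\<lambda>B. card (J \<inter> B)) ` schubert_bases I"
    unfolding rank_from_bases_def using base_in_schubert_bases by (intro Max_in) auto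
  thus ?thesis by auto
qed

lemma rank_le:
  fixes I :: "'n::{finite,linorder} set"
  assumes "down_closed L"
  shows "rank_from_bases (schubert_bases I) J \<le> card (J \<inter> L) + card (I - L)"
  using rank_attained[of I J] card_Int_base_le[OF _ assms] by (metis schubert_bases_iff)

text \<open>On each prefix the greedy set is maximal, so it attains the bound given by some lower
  set. No base can exceed that bound, so the rank is attained on the whole chain of prefixes by one
  base.\<close>

lemma greedy_base:
  fixes I :: "'n::{finite,linorder} set"
  assumes "distinct xs" "set xs = UNIV"
  shows "\<exists>B\<in>schubert_bases I. \<forall>k. card (set (take k xs) \<inter> B) = rank_from_bases (schubert_bases I) (set (take k xs))
     \<and> (\<exists>L. down_closed L \<and> card (set (take k xs) \<inter> B) = card (set (take k xs) \<inter> L) + card (I - L))"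
proof -
  obtain B where B: "schubert_indep I B" and max:
    "\<And>k y. k \<le> length xs \<Longrightarrow> y \<in> set (take k xs) - B \<Longrightarrow> \<not> schubert_indep I (insert y (B \<inter> set (take k xs)))"
    using greedy_indep[OF assms(1), of I] by auto
  have *: "\<exists>L. down_closed L \<and> card (set (take k xs) \<inter> B) = card (set (take k xs) \<inter> L) + card (I - L)"
    if "k \<le> length xs" for k
    using maximal_indep_card[of I "B \<inter> set (take k xs)" "set (take k xs)"] max[OF that]
      schubert_indep_mono[OF B, of "B \<inter> set (take k xs)"] by (auto simp: Int_commute)
  \<comment> \<open>For \<open>k\<close> beyond the length, \<open>take\<close> returns the whole
    list, so the case of full length applies.\<close>
  have **: "\<exists>L. down_closed L \<and> card (set (take k xs) \<inter> B) = card (set (take k xs) \<inter> L) + card (I - L)" for k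
    using *[of k] *[of "length xs"] by (cases "k \<le> length xs") auto
  \<comment> \<open>The bound for the full list is at least \<open>card I\<close>, and independence
    tested at the empty lower set gives the other inequality. So \<open>B\<close> has the size of a
    base.\<close>
  obtain L where L: "down_closed L" "card B = card L + card (I - L)"
    using **[of "length xs"] assms by auto
  have "card (B - {}) \<le> card (I - {})" using B unfolding schubert_indep_def by (metis down_closed_simps(1))
  moreover have "card I \<le> card L + card (I - L)"
    by (metis Un_Diff_cancel Un_upper2 card_Un_le card_mono finite le_trans)
  ultimately have "B \<in> schubert_bases I" using B L by (simp add: schubert_bases_iff)
  moreover have "rank_from_bases (schubert_bases I) (set (take k xs)) \<le> card (set (take k xs) \<inter> B)" for k
    using **[of k] rank_le by metis
  ultimately show ?thesis using rank_from_bases_ge[of "schubert_bases I" B] ** by (metis finite le_antisym)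
qed

text \<open>This is the minimum formula for the rank in threshold form, which avoids an explicit
  minimum. Every lower set bounds the rank, and a greedy base attains one of these bounds.\<close>

lemma le_rank_iff:
  fixes I :: "'n::{finite,linorder} set"
  shows "k \<le> rank_from_bases (schubert_bases I) J \<longleftrightarrow>
     (\<forall>L. down_closed L \<longrightarrow> k \<le> card (J \<inter> L) + card (I - L))"
proof
  show "k \<le> rank_from_bases (schubert_bases I) J \<Longrightarrow>
     (\<forall>L. down_closed L \<longrightarrow> k \<le> card (J \<inter> L) + card (I - L))"
    using rank_le le_trans by blast
next
  assume *: "\<forall>L. down_closed L \<longrightarrow> k \<le> card (J \<inter> L) + card (I - L)"
  \<comment> \<open>\<open>J\<close> is listed first, so that it is a prefix.\<close>
  define xs where "xs = sorted_list_of_set J @ sorted_list_of_set (-J)"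
  have "distinct xs" "set xs = UNIV" "set (take (card J) xs) = J" by (auto simp: xs_def)
  with greedy_base[of xs I] * show "k \<le> rank_from_bases (schubert_bases I) J"
    by metis
qed

lemma rank_empty: "rank_from_bases (schubert_bases I) {} = 0"
  for I :: "'n::{finite,linorder} set"
  using rank_le[of UNIV I "{}"] by simp

lemma rank_UNIV: "rank_from_bases (schubert_bases I) UNIV = card I"
  for I :: "'n::{finite,linorder} set"
  using rank_attained[of I UNIV] by (auto simp: schubert_bases_iff)

lemma schubert_rank_empty_set [simp]: "schubert_rank {} J = 0"
  using rank_le[of "{}" "{}" J] by (simp add: schubert_rank_def)

section \<open>Dominance order and linear independence of the rank functions\<close>

definition dominated :: "'n::linorder set \<Rightarrow> 'n set \<Rightarrow> bool" where
  "dominated K J \<longleftrightarrow> (\<forall>i. card (K \<inter> {..i}) \<le> card (J \<inter> {..i}))"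

lemma down_closed_cases:
  fixes L :: "'n::{finite,linorder} set"
  assumes "down_closed L"
  obtains "L = {}" | i where "L = {..i}"
proof (cases "L = {}")
  case False
  have "Max L \<in> L" using False by simp
  have "x \<in> L \<longleftrightarrow> x \<le> Max L" for x
    using assms \<open>Max L \<in> L\<close> Max_ge[OF finite, of x L] unfolding down_closed_def by blast
  hence "L = {..Max L}" by auto
  thus ?thesis using that by blast
qed

text \<open>The rank rises by at most one, and it rises precisely if it was below
  \<open>card (I \<inter> {a..})\<close>. Testing the opposite inequality on the lower sets
  \<open>{..i}\<close> gives the condition on \<open>a\<close> and dominance.\<close>

lemma schubert_rank_insert:
  fixes I :: "'n::{finite,linorder} set"
  assumes J: "J \<subseteq> {a<..}"
  shows "schubert_rank I (insert a J) - schubert_rank I J =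
    (if a \<notin> I \<and> dominated (I \<inter> {a<..}) J then 0 else 1)"
proof -
  let ?r = "rank_from_bases (schubert_bases I)"
  have ins: "card (insert a J \<inter> L) = card (J \<inter> L) + (if a \<in> L then 1 else 0)" for L
  proof -
    have "a \<notin> J" using J by auto
    thus ?thesis by (simp add: Int_insert_left)
  qed
  have mono: "?r J \<le> ?r (insert a J)"
    unfolding le_rank_iff
  proof (intro allI impI)
    fix L :: "'n set" assume "down_closed L"
    thus "?r J \<le> card (insert a J \<inter> L) + card (I - L)"
      using rank_le[of L I J] ins[of L] by simp
  qed
  have upper: "?r (insert a J) \<le> ?r J + 1"
  proof -
    have "\<not> Suc (?r J) \<le> ?r J" by simp
    then obtain L where "down_closed L" "card (J \<inter> L) + card (I - L) \<le> ?r J"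
      using le_rank_iff[of "Suc (?r J)" I J] by (auto simp: not_le less_Suc_eq_le)
    thus ?thesis using rank_le[of L I "insert a J"] ins[of L] by (auto split: if_splits)
  qed
  have below: "J \<inter> L = {} \<and> card (I \<inter> {a..}) \<le> card (I - L)" if "down_closed L" "a \<notin> L" for L
  proof -
    have "L \<subseteq> {..<a}" using that unfolding down_closed_def by (auto simp: not_le[symmetric])
    thus ?thesis using J by (force intro!: card_mono)
  qed
  \<comment> \<open>The lower set \<open>{..<a}\<close> shows necessity. For sufficiency, a lower
    set containing \<open>a\<close> gains one from \<open>a\<close>, and one avoiding
    \<open>a\<close> gives a bound of at least \<open>card (I \<inter> {a..})\<close>.\<close>
  have "Suc (?r J) \<le> ?r (insert a J) \<longleftrightarrow> Suc (?r J) \<le> card (I \<inter> {a..})"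
  proof
    assume "Suc (?r J) \<le> ?r (insert a J)"
    from this[unfolded le_rank_iff, rule_format, of "{..<a}"]
    have "Suc (?r J) \<le> card (insert a J \<inter> {..<a}) + card (I - {..<a})" by simp
    moreover have "insert a J \<inter> {..<a} = {}" "I - {..<a} = I \<inter> {a..}" using J by auto
    ultimately show "Suc (?r J) \<le> card (I \<inter> {a..})" by simp
  next
    assume *: "Suc (?r J) \<le> card (I \<inter> {a..})"
    show "Suc (?r J) \<le> ?r (insert a J)"
      unfolding le_rank_iff
    proof (intro allI impI)
      fix L :: "'n set" assume L: "down_closed L"
      show "Suc (?r J) \<le> card (insert a J \<inter> L) + card (I - L)"
        using ins[of L] rank_le[OF L, of I J] below[OF L] * by (cases "a \<in> L") auto
    qed
  qed
  \<comment> \<open>Taking \<open>i = a\<close> forces \<open>a\<close> out of \<open>I\<close>;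
    each \<open>i\<close> above \<open>a\<close> gives one dominance inequality, and those below
    \<open>a\<close> hold trivially.\<close>
  moreover have "card (I \<inter> {a..}) \<le> ?r J \<longleftrightarrow> a \<notin> I \<and> dominated (I \<inter> {a<..}) J"
  proof
    assume "card (I \<inter> {a..}) \<le> ?r J"
    hence *: "card (I \<inter> {a..}) \<le> card (J \<inter> {..i}) + card (I - {..i})" for i
      unfolding le_rank_iff by simp
    have "card (I \<inter> {a..}) \<le> card (I \<inter> {a<..})"
    proof -
      have "J \<inter> {..a} = {}" "I - {..a} = I \<inter> {a<..}" using J by auto
      thus ?thesis using *[of a] by simp
    qed
    hence a: "a \<notin> I"
    proof (rule contrapos_pn)
      assume "a \<in> I"
      hence "I \<inter> {a<..} \<subset> I \<inter> {a..}" by auto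
      thus "\<not> card (I \<inter> {a..}) \<le> card (I \<inter> {a<..})"
        by (simp add: not_le psubset_card_mono)
    qed
    have "card (I \<inter> {a<..} \<inter> {..i}) \<le> card (J \<inter> {..i})" for i
    proof (cases "a \<le> i")
      case True
      have "I \<inter> {a..} = (I \<inter> {a<..} \<inter> {..i}) \<union> (I - {..i})" "(I \<inter> {a<..} \<inter> {..i}) \<inter> (I - {..i}) = {}"
        using a True by (auto simp: order.strict_iff_order)
      hence "card (I \<inter> {a..}) = card (I \<inter> {a<..} \<inter> {..i}) + card (I - {..i})"
        by (metis card_Un_disjoint finite)
      thus ?thesis using *[of i] by simp
    next
      case False
      hence "I \<inter> {a<..} \<inter> {..i} = {}" by auto
      thus ?thesis by simp
    qed
    with a show "a \<notin> I \<and> dominated (I \<inter> {a<..}) J" by (simp add: dominated_def)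
  next
    assume *: "a \<notin> I \<and> dominated (I \<inter> {a<..}) J"
    show "card (I \<inter> {a..}) \<le> ?r J"
      unfolding le_rank_iff
    proof (intro allI impI)
      fix L :: "'n set" assume "down_closed L"
      thus "card (I \<inter> {a..}) \<le> card (J \<inter> L) + card (I - L)"
      proof (cases rule: down_closed_cases)
        case 1
        thus ?thesis by (simp add: card_mono)
      next
        case (2 i)
        have "I \<inter> {a..} \<subseteq> (I \<inter> {a<..} \<inter> {..i}) \<union> (I - {..i})"
          using * by (auto simp: order.strict_iff_order)
        hence "card (I \<inter> {a..}) \<le> card (I \<inter> {a<..} \<inter> {..i}) + card (I - {..i})"
          by (meson card_Un_le card_mono finite le_trans)
        thus ?thesis using * 2 unfolding dominated_def by (meson add_right_mono le_trans)
      qed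
    qed
  qed
  ultimately show ?thesis using mono upper unfolding schubert_rank_def by auto
qed

text \<open>At the least element of the symmetric difference the counts on initial intervals first
  diverge, by exactly one.\<close>

lemma dominated_antisym:
  fixes K :: "'n::{finite,linorder} set"
  assumes "dominated K J" "dominated J K"
  shows "K = J"
proof (rule ccontr)
  assume "K \<noteq> J"
  define D where "D = (K - J) \<union> (J - K)"
  have D: "D \<noteq> {}" using \<open>K \<noteq> J\<close> by (auto simp: D_def)
  define i where "i = Min D"
  have i: "i \<in> D" "\<And>j. j < i \<Longrightarrow> j \<notin> D" using D Min_in[of D] Min_le[of D] by (auto simp: i_def not_le[symmetric])
  have eq: "K \<inter> {..<i} = J \<inter> {..<i}" using i(2) by (auto simp: D_def)
  have split: "card (X \<inter> {..i}) = card (X \<inter> {..<i}) + (if i \<in> X then 1 else 0)" for X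
  proof -
    have "X \<inter> {..i} = (if i \<in> X then insert i (X \<inter> {..<i}) else X \<inter> {..<i})" by (auto simp: order.strict_iff_order)
    thus ?thesis by auto
  qed
  have "card (K \<inter> {..i}) = card (J \<inter> {..i})" using assms unfolding dominated_def by (meson le_antisym)
  thus False using i(1) eq split[of K] split[of J] unfolding D_def by (auto split: if_splits)
qed

lemma dominated_refl: "dominated K K" by (simp add: dominated_def)

lemma dominated_trans: "dominated K J \<Longrightarrow> dominated J M \<Longrightarrow> dominated K M"
  unfolding dominated_def by (meson le_trans)

text \<open>The zeta matrix of the dominance order is unitriangular.\<close>

lemma dominated_zeta_inj:
  fixes e :: "'n::{finite,linorder} set \<Rightarrow> real"
  assumes "\<And>J. J \<in> \<K> \<Longrightarrow> (\<Sum>K\<in>{K\<in>\<K>. dominated K J}. e K) = 0" and "J \<in> \<K>"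
  shows "e J = 0"
  using \<open>J \<in> \<K>\<close>
proof (induction "card {K\<in>\<K>. dominated K J}" arbitrary: J rule: less_induct)
  case less
  \<comment> \<open>A set of the family strictly dominated by \<open>J\<close> has strictly fewer
    members of the family below it, so induction leaves only the term of \<open>J\<close>.\<close>
  have "e K = 0" if K: "K \<in> {K\<in>\<K>. dominated K J} - {J}" for K
  proof (rule less.hyps)
    have "\<not> dominated J K" using K dominated_antisym by auto
    hence "{M\<in>\<K>. dominated M K} \<subset> {M\<in>\<K>. dominated M J}"
      using K less.prems dominated_trans[of _ K J] dominated_refl[of J] by auto
    thus "card {M\<in>\<K>. dominated M K} < card {M\<in>\<K>. dominated M J}"
      by (simp add: psubset_card_mono)
  qed (use K in auto)
  hence "(\<Sum>K\<in>{K\<in>\<K>. dominated K J}. e K) = e J"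
    by (subst sum.remove[of _ J]) (use less.prems dominated_refl in auto)
  thus ?case using assms(1)[OF less.prems] by simp
qed

text \<open>Group the coefficients by the trace of \<open>I\<close> on an upper set
  \<open>U\<close>. Each group with nonempty trace sums to 0, and the group with empty trace carries
  the total \<open>C\<close>. For \<open>U = UNIV\<close> the groups are single sets. The
  coefficient of the empty set has to be fixed because its rank function is zero.\<close>

lemma schubert_rank_independent:
  fixes c :: "'n::{finite,linorder} set \<Rightarrow> real"
  assumes zero: "\<And>J. (\<Sum>I\<in>UNIV. c I * schubert_rank I J) = 0" and "c {} = 0"
  shows "c I = 0"
proof -
  define C where "C = sum c UNIV"
  have main: "(\<Sum>I\<in>{I. I \<inter> U = K}. c I) = (if K = {} then C else 0)"
    if "\<And>x y. x \<in> U \<Longrightarrow> x \<le> y \<Longrightarrow> y \<in> U" "K \<subseteq> U" for U K :: "'n set"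
    using that
  proof (induction "card U" arbitrary: U K rule: less_induct)
    case less
    show ?case
    proof (cases "U = {}")
      case True
      thus ?thesis using less.prems by (simp add: C_def)
    next
      case False
      define a where "a = Min U"
      have a: "a \<in> U" "\<And>x. x \<in> U \<Longrightarrow> a \<le> x" using False by (auto simp: a_def)
      have U: "U = {a..}" using a less.prems(1) by auto
      have IH: "(\<Sum>I\<in>{I. I \<inter> {a<..} = K}. c I) = (if K = {} then C else 0)" if "K \<subseteq> {a<..}" for K
        using that by (intro less.hyps) (auto simp: U intro!: psubset_card_mono)
      define e where "e K = (\<Sum>I\<in>{I. I \<inter> {a..} = K}. c I)" for K
      \<comment> \<open>Subtract the relation at \<open>J\<close> from the relation at
        \<open>insert a J\<close>. By \<open>schubert_rank_insert\<close>, exactly the sets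
        \<open>I\<close> without \<open>a\<close> whose trace is dominated by \<open>J\<close> drop
        out of the total.\<close>
      have zeta: "(\<Sum>K\<in>{K\<in>Pow {a<..}. dominated K J}. e K) = C" if J: "J \<in> Pow {a<..}" for J
      proof -
        have "0 = (\<Sum>I\<in>UNIV. c I * (schubert_rank I (insert a J) - schubert_rank I J))"
          by (simp add: right_diff_distrib sum_subtractf zero)
        also have "\<dots> = (\<Sum>I\<in>UNIV. c I - (if a \<notin> I \<and> dominated (I \<inter> {a<..}) J then c I else 0))"
          using J by (intro sum.cong) (auto simp: schubert_rank_insert)
        also have "\<dots> = C - (\<Sum>I\<in>{I. a \<notin> I \<and> dominated (I \<inter> {a<..}) J}. c I)"
          by (simp add: sum_subtractf C_def sum.If_cases Collect_conj_eq)
        also have "{I. a \<notin> I \<and> dominated (I \<inter> {a<..}) J} =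
           (\<Union>K\<in>{K\<in>Pow {a<..}. dominated K J}. {I. I \<inter> {a..} = K})"
        proof -
          have "I \<inter> {a..} = I \<inter> {a<..}" if "a \<notin> I" for I using that by (auto simp: order.strict_iff_order)
          moreover have "a \<notin> I" if "I \<inter> {a..} \<subseteq> {a<..}" for I using that by auto
          ultimately have "a \<notin> I \<and> dominated (I \<inter> {a<..}) J \<longleftrightarrow>
              I \<inter> {a..} \<in> {K\<in>Pow {a<..}. dominated K J}" for I
            by (metis (no_types, lifting) Int_lower2 PowI PowD mem_Collect_eq)
          thus ?thesis by blast
        qed
        also have "(\<Sum>I\<in>\<dots>. c I) = (\<Sum>K\<in>{K\<in>Pow {a<..}. dominated K J}. e K)"
          unfolding e_def by (rule sum.UNION_disjoint) auto
        finally show ?thesis by simp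
      qed
      \<comment> \<open>The empty set is dominated by every \<open>J\<close>, so the value
        \<open>C\<close> at the empty trace already solves the system. The difference solves the
        homogeneous system and vanishes.\<close>
      define e' where "e' K = e K - (if K = {} then C else 0)" for K
      have "e' K = 0" if "K \<in> Pow {a<..}" for K
      proof (rule dominated_zeta_inj[of "Pow {a<..}"])
        fix J assume J: "J \<in> Pow {a<..}"
        have "(\<Sum>K\<in>{K\<in>Pow {a<..}. dominated K J}. if K = {} then C else 0) = C"
          by (simp add: dominated_def)
        thus "(\<Sum>K\<in>{K\<in>Pow {a<..}. dominated K J}. e' K) = 0"
          using zeta[OF J] by (simp add: e'_def sum_subtractf)
      qed fact
      hence e: "e K = (if K = {} then C else 0)" if "K \<subseteq> {a<..}" for K
        using that by (auto simp: e'_def)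
      show ?thesis
      proof (cases "a \<in> K")
        case False
        hence "K \<subseteq> {a<..}" using less.prems(2) U by (auto simp: order.strict_iff_order)
        from e[OF this] show ?thesis by (simp add: e_def U)
      next
        case True
        define K' where "K' = K - {a}"
        have K': "K' \<subseteq> {a<..}" "K = insert a K'" "a \<notin> K'"
          using less.prems(2) U True by (auto simp: K'_def order.strict_iff_order)
        \<comment> \<open>A trace above \<open>a\<close> splits according to whether
          \<open>a\<close> belongs to \<open>I\<close>. The induction hypothesis and the part
          without \<open>a\<close> have the same sum, which leaves 0 for the part with
          \<open>a\<close>.\<close>
        have "{I. I \<inter> {a<..} = K'} = {I. I \<inter> {a..} = K'} \<union> {I. I \<inter> {a..} = K}" (is "?X = ?Y \<union> ?Z")
        proof -
          have "{a..} = insert a {a<..}" by (auto simp: order.strict_iff_order)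
          thus ?thesis using K' by auto
        qed
        moreover have "?Y \<inter> ?Z = {}" using K' by auto
        ultimately have "sum c ?X = e K' + e K" unfolding e_def by (simp add: sum.union_disjoint)
        thus ?thesis using IH[OF K'(1)] e[OF K'(1)] K'(2) by (simp add: e_def U)
      qed
    qed
  qed
  have single: "(\<Sum>I\<in>{I. I \<inter> UNIV = K}. c I) = c K" for K by simp
  have "C = 0" using main[of UNIV "{}"] single[of "{}"] \<open>c {} = 0\<close> by simp
  thus ?thesis using main[of UNIV I] single[of I] by simp
qed

section \<open>The basis of the space of set functions vanishing at the empty set\<close>

interpretation set_fun: vector_space set_fun_scale
  by unfold_locales (auto simp: set_fun_scale_def plus_fun_def algebra_simps)

lemma set_fun_sum_apply: "(\<Sum>v\<in>S. f v) J = (\<Sum>v\<in>S. f v J)"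
  for f :: "'b \<Rightarrow> 'n set \<Rightarrow> real"
  by (induction S rule: infinite_finite_induct) auto

lemma schubert_rank_basis:
  "family_basis_of set_fun_scale {I. I \<noteq> {}}
       (schubert_rank :: 'n::{finite,linorder} set \<Rightarrow> 'n set \<Rightarrow> real) {f. f {} = 0}"
proof -
  let ?N = "{I :: 'n set. I \<noteq> {}}"
  let ?b = "schubert_rank :: 'n set \<Rightarrow> 'n set \<Rightarrow> real"
  define V where "V = {f :: 'n set \<Rightarrow> real. f {} = 0}"
  have inj: "inj_on ?b ?N"
  proof (rule inj_onI, rule ccontr)
    fix I J assume I: "I \<in> ?N" "J \<in> ?N" "?b I = ?b J" "I \<noteq> J"
    \<comment> \<open>Two equal rank functions at distinct sets would give a relation with
      coefficients 1 and -1.\<close>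
    define c where "c K = (if K = I then 1 else 0) - (if K = J then 1 else 0 :: real)" for K
    have "(\<Sum>K\<in>UNIV. c K * schubert_rank K M) = 0" for M
    proof -
      have "(\<Sum>K\<in>UNIV. c K * schubert_rank K M) = (\<Sum>K\<in>UNIV. (if K = I then ?b I M else 0) - (if K = J then ?b J M else 0))"
        using I(4) by (intro sum.cong) (auto simp: c_def)
      thus ?thesis using I by (simp add: sum_subtractf)
    qed
    from schubert_rank_independent[of c, OF this, of I] I show False by (simp add: c_def)
  qed
  have indep: "\<not> set_fun.dependent (?b ` ?N)"
    unfolding set_fun.dependent_finite[OF finite_imageI[OF finite]]
  proof (intro notI, elim exE conjE bexE)
    fix u v assume v: "v \<in> ?b ` ?N" "u v \<noteq> 0" and u: "(\<Sum>v\<in>?b ` ?N. set_fun_scale (u v) v) = 0"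
    \<comment> \<open>Extending by 0 to the empty set puts the relation into the form of
      \<open>schubert_rank_independent\<close>.\<close>
    define c where "c I = (if I = {} then 0 else u (?b I))" for I
    have "(\<Sum>I\<in>UNIV. c I * ?b I J) = 0" for J
    proof -
      have "(\<Sum>I\<in>UNIV. c I * ?b I J) = (\<Sum>I\<in>?N. u (?b I) * ?b I J)"
        by (intro sum.mono_neutral_cong_right) (auto simp: c_def)
      also have "\<dots> = (\<Sum>v\<in>?b ` ?N. u v * v J)" by (simp add: sum.reindex[OF inj])
      also have "\<dots> = (\<Sum>v\<in>?b ` ?N. set_fun_scale (u v) v) J"
        by (simp add: set_fun_sum_apply set_fun_scale_def)
      finally show ?thesis by (simp add: u)
    qed
    from schubert_rank_independent[of c, OF this] have "c I = 0" for I by (simp add: c_def)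
    moreover obtain I where "I \<noteq> {}" "v = ?b I" using v by auto
    ultimately show False using v by (metis c_def)
  qed
  \<comment> \<open>These indicator functions span \<open>V\<close> and are indexed by the same
    nonempty sets, so they bound the size of an independent family in \<open>V\<close>.\<close>
  define d where "d I = (\<lambda>J. if J = I then 1 else 0 :: real)" for I :: "'n set"
  have subspace: "set_fun.subspace V"
    by (simp add: set_fun.subspace_def V_def set_fun_scale_def)
  have bV: "?b ` ?N \<subseteq> V" by (auto simp: V_def schubert_rank_def rank_empty)
  have Vd: "V \<subseteq> set_fun.span (d ` ?N)"
  proof
    fix f assume f: "f \<in> V"
    have "f = (\<Sum>I\<in>?N. set_fun_scale (f I) (d I))"
    proof
      fix J
      have "(\<Sum>I\<in>?N. set_fun_scale (f I) (d I)) J = (\<Sum>I\<in>?N. if J = I then f I else 0)"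
        unfolding set_fun_sum_apply set_fun_scale_def d_def by (rule sum.cong) auto
      also have "\<dots> = f J" using f by (auto simp: V_def)
      finally show "f J = (\<Sum>I\<in>?N. set_fun_scale (f I) (d I)) J" by simp
    qed
    moreover have "\<dots> \<in> set_fun.span (d ` ?N)"
      by (intro set_fun.span_sum set_fun.span_scale set_fun.span_base) auto
    ultimately show "f \<in> set_fun.span (d ` ?N)" by simp
  qed
  have "V \<subseteq> set_fun.span (?b ` ?N)"
  proof (rule ccontr)
    assume "\<not> ?thesis"
    then obtain v where v: "v \<in> V" "v \<notin> set_fun.span (?b ` ?N)" by auto
    hence "\<not> set_fun.dependent (insert v (?b ` ?N))" using indep set_fun.independent_insertI by auto
    moreover have "insert v (?b ` ?N) \<subseteq> set_fun.span (d ` ?N)" using v bV Vd by auto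
    ultimately have "card (insert v (?b ` ?N)) \<le> card (d ` ?N)"
      using set_fun.independent_span_bound[of "d ` ?N"] by auto
    moreover have "v \<notin> ?b ` ?N"
    proof
      assume "v \<in> ?b ` ?N"
      hence "v \<in> set_fun.span (?b ` ?N)" by (rule set_fun.span_base)
      with v(2) show False by contradiction
    qed
    ultimately have "Suc (card ?N) \<le> card (d ` ?N)" by (simp add: card_image[OF inj])
    thus False using card_image_le[of ?N d] by simp
  qed
  moreover have "set_fun.span (?b ` ?N) \<subseteq> V" using set_fun.span_minimal[OF bV subspace] .
  ultimately show ?thesis using inj indep unfolding family_basis_of_def V_def by auto
qed

section \<open>Exponents of the dual character\<close>

lemma lookup_mpoly_scale:
  "Poly_Mapping.lookup (mpoly_scale c p) m = c * Poly_Mapping.lookup p m"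
  unfolding mpoly_scale_def mpoly_const_def mult_map_scale_conv_mult[symmetric]
  by (simp add: Poly_Mapping.map.rep_eq when_def)

interpretation mpoly: vector_space mpoly_scale
  by unfold_locales
    (auto intro!: poly_mapping_eqI simp: lookup_mpoly_scale lookup_add algebra_simps)

section \<open>Traces and eigenbases\<close>

context vector_space
begin

text \<open>Expanding \<open>T b\<close> in \<open>B'\<close> and then each \<open>b'\<close> in
  \<open>B\<close> turns both traces into the same double sum, the trace of a product of two
  matrices taken in either order.\<close>

lemma trace_basis_independent:
  assumes B: "independent B" "finite B" "span B = V"
    and B': "independent B'" "finite B'" "span B' = V"
    and T: "\<And>v. v \<in> V \<Longrightarrow> T v \<in> V"
    and add: "\<And>u v. u \<in> V \<Longrightarrow> v \<in> V \<Longrightarrow> T (u + v) = T u + T v"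
    and scale: "\<And>c v. v \<in> V \<Longrightarrow> T (scale c v) = scale c (T v)"
  shows "(\<Sum>b\<in>B. representation B (T b) b) = (\<Sum>b\<in>B'. representation B' (T b) b)"
proof -
  have sub: "B \<subseteq> V" "B' \<subseteq> V" using span_superset B B' by blast+
  have zeroV: "0 \<in> V" using B span_zero by blast
  have sumV: "(\<Sum>a\<in>A. scale (f a) a) \<in> V" if "A \<subseteq> V" for A f
    using that B span_sum span_scale by (metis (no_types, lifting) subsetD)
  have T_sum: "T (\<Sum>a\<in>A. scale (f a) a) = (\<Sum>a\<in>A. scale (f a) (T a))" if "finite A" "A \<subseteq> V" for A f
    using that
  proof (induction A rule: finite_induct)
    case empty
    show ?case using scale[OF zeroV, of 0] by simp
  next
    case (insert x A)
    thus ?case using sumV[of A f] scale add B span_scale by auto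
  qed
  have "(\<Sum>b\<in>B. representation B (T b) b) =
      (\<Sum>b\<in>B. \<Sum>b'\<in>B'. representation B' (T b) b' * representation B b' b)"
  proof (rule sum.cong)
    fix b assume b: "b \<in> B"
    hence "T b = (\<Sum>b'\<in>B'. scale (representation B' (T b) b') b')"
      using sum_representation_eq[OF B'(1) _ B'(2)] T sub B' by auto
    hence "representation B (T b) b = representation B (\<Sum>b'\<in>B'. scale (representation B' (T b) b') b') b" by simp
    also have "\<dots> = (\<Sum>b'\<in>B'. representation B (scale (representation B' (T b) b') b') b)"
      using sub B by (subst representation_sum) (auto intro!: span_scale)
    also have "\<dots> = (\<Sum>b'\<in>B'. representation B' (T b) b' * representation B b' b)"
      using sub B by (intro sum.cong refl) (auto simp: representation_scale subset_iff)
    finally show "representation B (T b) b = (\<Sum>b'\<in>B'. representation B' (T b) b' * representation B b' b)" .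
  qed simp
  also have "\<dots> = (\<Sum>b'\<in>B'. \<Sum>b\<in>B. representation B b' b * representation B' (T b) b')"
    by (subst sum.swap) (simp add: mult.commute)
  also have "\<dots> = (\<Sum>b'\<in>B'. representation B' (T b') b')"
  proof (rule sum.cong)
    fix b' assume b': "b' \<in> B'"
    hence "b' = (\<Sum>b\<in>B. scale (representation B b' b) b)"
      using sum_representation_eq[OF B(1) _ B(2)] sub B by auto
    hence "T b' = (\<Sum>b\<in>B. scale (representation B b' b) (T b))"
      using T_sum[OF B(2) sub(1)] by metis
    hence "representation B' (T b') b' = representation B' (\<Sum>b\<in>B. scale (representation B b' b) (T b)) b'" by simp
    also have "\<dots> = (\<Sum>b\<in>B. representation B' (scale (representation B b' b) (T b)) b')"
      using sub B' T by (subst representation_sum) (auto intro!: span_scale)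
    also have "\<dots> = (\<Sum>b\<in>B. representation B b' b * representation B' (T b) b')"
      using sub B' T by (intro sum.cong refl) (auto simp: representation_scale subset_iff)
    finally show "(\<Sum>b\<in>B. representation B b' b * representation B' (T b) b') = representation B' (T b') b'" ..
  qed simp
  finally show ?thesis .
qed

text \<open>\<open>trace_on\<close> works with an arbitrarily chosen basis. Independence of the
  basis allows passing to the eigenbasis, where the matrix is diagonal.\<close>

lemma trace_on_eigenbasis:
  assumes B: "independent B" "finite B"
    and eigen: "\<And>b. b \<in> B \<Longrightarrow> T b = scale (e b) b"
    and add: "\<And>u v. u \<in> span B \<Longrightarrow> v \<in> span B \<Longrightarrow> T (u + v) = T u + T v"
    and scale: "\<And>c v. v \<in> span B \<Longrightarrow> T (scale c v) = scale c (T v)"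
  shows "trace_on scale (span B) T = (\<Sum>b\<in>B. e b)"
proof -
  define B' where "B' = (SOME B'. independent B' \<and> span B' = span B)"
  have B': "independent B'" "span B' = span B"
    using someI[of "\<lambda>B'. independent B' \<and> span B' = span B" B] B by (auto simp: B'_def)
  have fin: "finite B'" using independent_span_bound[OF B(2) B'(1)] span_superset[of B'] B'(2) by auto
  have "v \<in> span B \<and> T v \<in> span B" if "v \<in> span B" for v
    using that
  proof (induction rule: span_induct_alt)
    case base
    show ?case using scale[OF span_zero, of 0] by (simp add: span_zero)
  next
    case (step c x y)
    hence x: "x \<in> span B" and y: "y \<in> span B" by (auto intro: span_base)
    hence "T (scale c x + y) = scale c (scale (e x) x) + T y"
      using add[OF span_scale[OF x] y] scale[OF x] eigen[OF step(1)] by simp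
    thus ?case using step x by (auto intro!: span_add span_scale)
  qed
  hence T: "v \<in> span B \<Longrightarrow> T v \<in> span B" for v by blast
  have "trace_on scale (span B) T = (\<Sum>b\<in>B'. representation B' (T b) b)"
    unfolding trace_on_def Let_def B'_def ..
  also have "\<dots> = (\<Sum>b\<in>B. representation B (T b) b)"
    by (rule trace_basis_independent[OF B'(1) fin B'(2) B(1,2) refl T add scale])
  also have "\<dots> = (\<Sum>b\<in>B. e b)"
    using B by (intro sum.cong) (auto simp: eigen representation_scale span_base representation_basis)
  finally show ?thesis .
qed

end

section \<open>Separating monomials by integer weights\<close>

text \<open>The weights are powers of \<open>N\<close>, so the values of \<open>f\<close> are the
  base-\<open>N\<close> digits of the weighted sum. The new index receives the last digit, read off
  modulo \<open>N\<close>, and the old weights are multiplied by \<open>N\<close>.\<close>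

lemma digit_weights_exist:
  fixes N :: nat
  assumes "finite V"
  shows "\<exists>u. \<forall>f g. (\<forall>v\<in>V. f v < N \<and> g v < N) \<longrightarrow> (\<Sum>v\<in>V. f v * u v) = (\<Sum>v\<in>V. g v * u v)
     \<longrightarrow> (\<forall>v\<in>V. f v = (g v :: nat))"
  using assms
proof (induction V rule: finite_induct)
  case (insert a V)
  then obtain u where u: "\<And>f g v. (\<And>v. v \<in> V \<Longrightarrow> f v < N \<and> g v < N) \<Longrightarrow>
      (\<Sum>v\<in>V. f v * u v) = (\<Sum>v\<in>V. g v * u v) \<Longrightarrow> v \<in> V \<Longrightarrow> f v = (g v :: nat)"
    by blast
  define u' where "u' v = (if v = a then 1 else N * u v)" for v
  have sum: "(\<Sum>v\<in>insert a V. f v * u' v) = f a + N * (\<Sum>v\<in>V. f v * u v)" for f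
  proof -
    have "(\<Sum>v\<in>V. f v * u' v) = N * (\<Sum>v\<in>V. f v * u v)"
      unfolding sum_distrib_left by (rule sum.cong) (use insert.hyps in \<open>auto simp: u'_def\<close>)
    thus ?thesis using insert.hyps by (simp add: u'_def)
  qed
  show ?case
  proof (intro exI[of _ u'] allI impI)
    fix f g :: "'a \<Rightarrow> nat"
    assume N: "\<forall>v\<in>insert a V. f v < N \<and> g v < N"
      and eq: "(\<Sum>v\<in>insert a V. f v * u' v) = (\<Sum>v\<in>insert a V. g v * u' v)"
    have eq': "f a + N * (\<Sum>v\<in>V. f v * u v) = g a + N * (\<Sum>v\<in>V. g v * u v)"
      using eq unfolding sum .
    have "f a = (f a + N * (\<Sum>v\<in>V. f v * u v)) mod N" using N by simp
    also have "\<dots> = g a" unfolding eq' using N by simp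
    finally have a: "f a = g a" .
    moreover have "N > 0" using N by auto
    ultimately have "(\<Sum>v\<in>V. f v * u v) = (\<Sum>v\<in>V. g v * u v)" using eq' by simp
    hence "f v = g v" if "v \<in> V" for v using u[OF _ _ that, of f g] N by blast
    thus "\<forall>v\<in>insert a V. f v = g v" using a by blast
  qed
qed simp

lemma monomial_weights_exist:
  fixes K :: "('v::finite \<Rightarrow>\<^sub>0 nat) set"
  assumes "finite K"
  shows "\<exists>u::'v \<Rightarrow> nat. inj_on (\<lambda>m. \<Sum>v\<in>UNIV. Poly_Mapping.lookup m v * u v) K"
proof -
  define N where "N = Suc (Max (insert 0 ((\<lambda>(m, v). Poly_Mapping.lookup m v) ` (K \<times> UNIV))))"
  have N: "Poly_Mapping.lookup m v < N" if "m \<in> K" for m v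
    unfolding N_def using that assms by (intro le_imp_less_Suc Max_ge) force+
  have "\<exists>u :: 'v \<Rightarrow> nat. \<forall>f g. (\<forall>v. f v < N \<and> g v < N) \<longrightarrow>
      (\<Sum>v\<in>UNIV. f v * u v) = (\<Sum>v\<in>UNIV. g v * u v) \<longrightarrow> (\<forall>v. f v = g v)"
    using digit_weights_exist[of "UNIV :: 'v set" N] by simp
  then obtain u :: "'v \<Rightarrow> nat" where u: "\<forall>f g. (\<forall>v. f v < N \<and> g v < N) \<longrightarrow>
      (\<Sum>v\<in>UNIV. f v * u v) = (\<Sum>v\<in>UNIV. g v * u v) \<longrightarrow> (\<forall>v. f v = g v)" ..
  have "inj_on (\<lambda>m. \<Sum>v\<in>UNIV. Poly_Mapping.lookup m v * u v) K"
  proof (intro inj_onI poly_mapping_eqI)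
    fix m m' v assume "m \<in> K" "m' \<in> K"
      "(\<Sum>v\<in>UNIV. Poly_Mapping.lookup m v * u v) = (\<Sum>v\<in>UNIV. Poly_Mapping.lookup m' v * u v)"
    thus "Poly_Mapping.lookup m v = Poly_Mapping.lookup m' v"
      using u[rule_format, of "Poly_Mapping.lookup m" "Poly_Mapping.lookup m'" v] N by blast
  qed
  thus ?thesis by blast
qed

lemma sum_single_lookup: "(\<Sum>m\<in>Poly_Mapping.keys p. Poly_Mapping.single m (Poly_Mapping.lookup p m)) = p"
  by (rule poly_mapping_eqI) (simp add: lookup_sum lookup_single when_def in_keys_iff)

text \<open>With an additive weight that is injective on both supports, each factor has a unique
  heaviest monomial. Their product arises in only one way, so it cannot cancel.\<close>

lemma mpoly_mult_nonzero:
  fixes p q :: "('v::finite, 'a::idom) mpoly"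
  assumes "p \<noteq> 0" "q \<noteq> 0"
  shows "p * q \<noteq> 0"
proof -
  let ?P = "Poly_Mapping.keys p" and ?Q = "Poly_Mapping.keys q"
  obtain u :: "'v \<Rightarrow> nat" where "inj_on (\<lambda>m. \<Sum>v\<in>UNIV. Poly_Mapping.lookup m v * u v) (?P \<union> ?Q)"
    using monomial_weights_exist[of "?P \<union> ?Q"] by auto
  moreover define w where "w m = (\<Sum>v\<in>UNIV. Poly_Mapping.lookup m v * u v)" for m
  ultimately have inj: "inj_on w (?P \<union> ?Q)" by (simp add: w_def[abs_def])
  have w_add: "w (a + b) = w a + w b" for a b
    by (simp add: w_def lookup_add add_mult_distrib sum.distrib)
  have ne: "?P \<noteq> {}" "?Q \<noteq> {}" using assms by (auto simp: poly_mapping_eq_iff in_keys_iff fun_eq_iff)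
  have max: "\<exists>a\<in>S. \<forall>m\<in>S. w m \<le> w a" if "finite S" "S \<noteq> {}" for S
  proof -
    have "Max (w ` S) \<in> w ` S" using that by (intro Max_in) auto
    then obtain a where "a \<in> S" "Max (w ` S) = w a" by auto
    moreover have "\<forall>m\<in>S. w m \<le> Max (w ` S)" using that by simp
    ultimately show ?thesis by auto
  qed
  obtain a where a: "a \<in> ?P" "\<And>m. m \<in> ?P \<Longrightarrow> w m \<le> w a"
    using max[of ?P] ne by auto
  obtain b where b: "b \<in> ?Q" "\<And>m. m \<in> ?Q \<Longrightarrow> w m \<le> w b"
    using max[of ?Q] ne by auto
  have uniq: "m + m' = a + b \<longleftrightarrow> m = a \<and> m' = b" if "m \<in> ?P" "m' \<in> ?Q" for m m'
  proof
    assume *: "m + m' = a + b"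
    hence "w m + w m' = w a + w b" by (metis w_add)
    hence "w m = w a" "w m' = w b" using a(2)[OF that(1)] b(2)[OF that(2)] by auto
    thus "m = a \<and> m' = b" using inj that a b by (auto dest: inj_onD)
  qed auto
  have "p * q = (\<Sum>m\<in>?P. Poly_Mapping.single m (Poly_Mapping.lookup p m)) * (\<Sum>m'\<in>?Q. Poly_Mapping.single m' (Poly_Mapping.lookup q m'))"
    by (simp add: sum_single_lookup)
  also have "\<dots> = (\<Sum>m\<in>?P. \<Sum>m'\<in>?Q. Poly_Mapping.single (m + m') (Poly_Mapping.lookup p m * Poly_Mapping.lookup q m'))"
    by (simp add: sum_product mult_single)
  finally have "Poly_Mapping.lookup (p * q) (a + b) =
      (\<Sum>m\<in>?P. \<Sum>m'\<in>?Q. (if m' = b then if m = a then Poly_Mapping.lookup p m * Poly_Mapping.lookup q m' else 0 else 0))"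
    by (auto simp: lookup_sum lookup_single when_def uniq intro!: sum.cong)
  also have "\<dots> = Poly_Mapping.lookup p a * Poly_Mapping.lookup q b"
    using a b by simp
  finally show ?thesis using a b by (auto simp: in_keys_iff)
qed

lemma mpoly_prod_nonzero:
  fixes f :: "'i \<Rightarrow> ('v::finite, 'a::idom) mpoly"
  assumes "\<And>i. i \<in> A \<Longrightarrow> f i \<noteq> 0"
  shows "(\<Prod>i\<in>A. f i) \<noteq> 0"
  using assms by (induction A rule: infinite_finite_induct) (simp_all add: mpoly_mult_nonzero)

text \<open>The product runs over all variables instead of the keys, so addition of exponents
  becomes multiplication without any comparison of supports.\<close>

definition monomial_value :: "('v::finite \<Rightarrow> 'a::comm_semiring_1) \<Rightarrow> ('v \<Rightarrow>\<^sub>0 nat) \<Rightarrow> 'a" where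
  "monomial_value x m = (\<Prod>v\<in>UNIV. x v ^ Poly_Mapping.lookup m v)"

lemma monomial_value_0 [simp]: "monomial_value x 0 = 1"
  by (simp add: monomial_value_def)

lemma monomial_value_add: "monomial_value x (a + b) = monomial_value x a * monomial_value x b"
  by (simp add: monomial_value_def lookup_add power_add prod.distrib)

lemma monomial_value_sum: "monomial_value x (\<Sum>i\<in>A. f i) = (\<Prod>i\<in>A. monomial_value x (f i))"
  by (induction A rule: infinite_finite_induct) (auto simp: monomial_value_add)

lemma monomial_value_single: "monomial_value x (Poly_Mapping.single v k) = x v ^ k"
proof -
  have "monomial_value x (Poly_Mapping.single v k) = (\<Prod>w\<in>UNIV. if w = v then x v ^ k else 1)"
    unfolding monomial_value_def by (intro prod.cong) (auto simp: lookup_single when_def)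
  thus ?thesis by simp
qed

lemma monomial_value_keys:
  "monomial_value x m = (\<Prod>v\<in>Poly_Mapping.keys m. x v ^ Poly_Mapping.lookup m v)"
  unfolding monomial_value_def
  by (rule prod.mono_neutral_right) (auto simp: in_keys_iff)

lemma mpoly_eval_superset:
  fixes p :: "('v::finite, 'a::comm_semiring_1) mpoly"
  assumes "finite K" "Poly_Mapping.keys p \<subseteq> K"
  shows "mpoly_eval (\<lambda>c. c) x p = (\<Sum>m\<in>K. Poly_Mapping.lookup p m * monomial_value x m)"
  unfolding mpoly_eval_def monomial_value_keys[symmetric]
  by (rule sum.mono_neutral_left) (use assms in \<open>auto simp: in_keys_iff\<close>)

text \<open>On a generic one-parameter subgroup of the torus, distinct monomials restrict to distinct
  powers of the parameter.\<close>

lemma mpoly_eqI_torus: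
  fixes p q :: "('v::finite, complex) mpoly"
  assumes eq: "\<And>x. (\<forall>i. x i \<noteq> 0) \<Longrightarrow> mpoly_eval (\<lambda>c. c) x p = mpoly_eval (\<lambda>c. c) x q"
  shows "p = q"
proof -
  define K where "K = Poly_Mapping.keys p \<union> Poly_Mapping.keys q"
  obtain u :: "'v \<Rightarrow> nat" where "inj_on (\<lambda>m. \<Sum>v\<in>UNIV. Poly_Mapping.lookup m v * u v) K"
    using monomial_weights_exist[of K] by (auto simp: K_def)
  moreover define w where "w m = (\<Sum>v\<in>UNIV. Poly_Mapping.lookup m v * u v)" for m
  ultimately have inj: "inj_on w K" by (simp add: w_def[abs_def])
  define c where "c m = Poly_Mapping.lookup p m - Poly_Mapping.lookup q m" for m
  \<comment> \<open>\<open>r\<close> is \<open>p - q\<close> along the curve with coordinates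
    \<open>t ^ u v\<close>. It vanishes for all nonzero \<open>t\<close>, and each of its nonzero
    coefficients would be that of a single monomial.\<close>
  define r where "r = (\<Sum>m\<in>K. monom (c m) (w m))"
  have "poly r t = 0" if "t \<noteq> 0" for t
  proof -
    have mv: "monomial_value (\<lambda>v. t ^ u v) m = t ^ w m" for m
      by (simp add: monomial_value_def w_def power_sum power_mult[symmetric] mult.commute)
    have "poly r t = (\<Sum>m\<in>K. c m * t ^ w m)" by (simp add: r_def poly_sum poly_monom)
    also have "\<dots> = mpoly_eval (\<lambda>c. c) (\<lambda>v. t ^ u v) p - mpoly_eval (\<lambda>c. c) (\<lambda>v. t ^ u v) q"
      by (subst (1 2) mpoly_eval_superset[where K = K]) 
        (auto simp: K_def c_def mv left_diff_distrib sum_subtractf)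
    also have "\<dots> = 0" using eq[of "\<lambda>v. t ^ u v"] that by simp
    finally show ?thesis .
  qed
  hence "UNIV - {0} \<subseteq> {t. poly r t = 0}" by auto
  moreover have "infinite (UNIV - {0 :: complex})" by (simp add: infinite_UNIV_char_0)
  ultimately have "r = 0" using poly_roots_finite finite_subset by blast
  have "c m = 0" if m: "m \<in> K" for m
  proof -
    have "0 = coeff r (w m)" using \<open>r = 0\<close> by simp
    also have "\<dots> = (\<Sum>m'\<in>K. if m' = m then c m' else 0)"
      unfolding r_def coeff_sum using inj m by (intro sum.cong) (auto dest: inj_onD)
    also have "\<dots> = c m" using m by (simp add: K_def)
    finally show ?thesis ..
  qed
  moreover have "c m = 0" if "m \<notin> K" for m
    using that by (simp add: c_def K_def in_keys_iff)
  ultimately show ?thesis by (intro poly_mapping_eqI) (metis c_def right_minus_eq)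
qed

section \<open>Row degrees and minors of the generic matrix\<close>

text \<open>This is the torus weight of a monomial: the diagonal action scales a variable by a
  factor depending only on its row.\<close>

definition row_degree :: "('n::finite \<times> 'n \<Rightarrow>\<^sub>0 nat) \<Rightarrow> ('n \<Rightarrow>\<^sub>0 nat)" where
  "row_degree m = (\<Sum>v\<in>UNIV. Poly_Mapping.single (fst v) (Poly_Mapping.lookup m v))"

lemma row_degree_0 [simp]: "row_degree 0 = 0"
  by (simp add: row_degree_def)

lemma row_degree_add: "row_degree (a + b) = row_degree a + row_degree b"
  by (simp add: row_degree_def lookup_add single_add sum.distrib)

lemma row_degree_single: "row_degree (Poly_Mapping.single v k) = Poly_Mapping.single (fst v) k"
proof -
  have "row_degree (Poly_Mapping.single v k) = (\<Sum>w\<in>UNIV. if w = v then Poly_Mapping.single (fst v) k else 0)"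
    unfolding row_degree_def by (intro sum.cong) (auto simp: lookup_single when_def)
  thus ?thesis by simp
qed

lemma monomial_value_row_degree:
  "monomial_value x (row_degree m) = (\<Prod>v\<in>Poly_Mapping.keys m. x (fst v) ^ Poly_Mapping.lookup m v)"
  unfolding row_degree_def monomial_value_sum monomial_value_single
  by (rule prod.mono_neutral_right) (auto simp: in_keys_iff)

text \<open>The action substitutes entries of a product with the generic matrix, which for a
  diagonal matrix kills variables below the diagonal. Weights therefore make sense only for these
  monomials.\<close>

definition upper_monomial :: "('n::linorder \<times> 'n \<Rightarrow>\<^sub>0 nat) \<Rightarrow> bool" where
  "upper_monomial m \<longleftrightarrow> (\<forall>v\<in>Poly_Mapping.keys m. fst v \<le> snd v)"

lemma upper_monomial_add: "upper_monomial a \<Longrightarrow> upper_monomial b \<Longrightarrow> upper_monomial (a + b)"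
  using Poly_Mapping.keys_add[of a b] unfolding upper_monomial_def by blast

definition upper_poly :: "'n::{finite,linorder} ypoly \<Rightarrow> bool" where
  "upper_poly p \<longleftrightarrow> (\<forall>m\<in>Poly_Mapping.keys p. upper_monomial m)"

lemma subspace_upper_poly: "mpoly.subspace {p. upper_poly p}"
  by (auto simp: mpoly.subspace_def upper_poly_def in_keys_iff lookup_add lookup_mpoly_scale)

definition row_homogeneous :: "('n::{finite,linorder} \<Rightarrow>\<^sub>0 nat) \<Rightarrow> 'n ypoly \<Rightarrow> bool" where
  "row_homogeneous \<alpha> p \<longleftrightarrow> (\<forall>m\<in>Poly_Mapping.keys p. upper_monomial m \<and> row_degree m = \<alpha>)"

lemma row_homogeneous_0 [simp]: "row_homogeneous \<alpha> 0"
  by (simp add: row_homogeneous_def)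

lemma row_homogeneous_1 [simp]: "row_homogeneous 0 1"
  by (simp add: row_homogeneous_def upper_monomial_def)

lemma row_homogeneous_sum:
  "(\<And>i. i \<in> A \<Longrightarrow> row_homogeneous \<alpha> (f i)) \<Longrightarrow> row_homogeneous \<alpha> (\<Sum>i\<in>A. f i)"
  using Poly_Mapping.keys_sum[of f A] unfolding row_homogeneous_def by blast

lemma row_homogeneous_uminus: "row_homogeneous \<alpha> p \<Longrightarrow> row_homogeneous \<alpha> (- p)"
  unfolding row_homogeneous_def in_keys_iff by simp

lemma row_homogeneous_mult:
  "row_homogeneous \<alpha> p \<Longrightarrow> row_homogeneous \<beta> q \<Longrightarrow> row_homogeneous (\<alpha> + \<beta>) (p * q)"
  using Poly_Mapping.keys_mult[of p q] unfolding row_homogeneous_def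
  by (fastforce simp: row_degree_add upper_monomial_add)

lemma row_homogeneous_prod:
  "(\<And>i. i \<in> A \<Longrightarrow> row_homogeneous (\<alpha> i) (f i)) \<Longrightarrow> row_homogeneous (\<Sum>i\<in>A. \<alpha> i) (\<Prod>i\<in>A. f i)"
  by (induction A rule: infinite_finite_induct) (auto intro: row_homogeneous_mult)

lemma row_homogeneous_generic_matrix:
  "row_homogeneous (Poly_Mapping.single i 1) (vec_nth (vec_nth generic_matrix i) j)"
  by (auto simp: generic_matrix_def row_homogeneous_def mpoly_var_def upper_monomial_def row_degree_single)

lemma minor_generic_matrix:
  fixes R S :: "'n::{finite,linorder} set"
  assumes "card S = card R"
  shows "minor generic_matrix R S = (\<Sum>p | p permutes {0..<card S}. of_int (sign p) *
     (\<Prod>i = 0..<card S. vec_nth (vec_nth generic_matrix (sorted_list_of_set S ! i)) (sorted_list_of_set R ! p i)))"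
proof -
  have "p i < card R" if "p permutes {0..<card S}" "i < card S" for p i
    using permutes_in_image[OF that(1), of i] that(2) assms by simp
  thus ?thesis
    unfolding minor_def Determinant.det_def using assms by (auto intro!: sum.cong prod.cong)
qed

lemma sum_nth_sorted_list_of_set:
  "finite S \<Longrightarrow> (\<Sum>i = 0..<card S. f (sorted_list_of_set S ! i)) = (\<Sum>x\<in>S. f x)"
  by (rule sum.reindex_bij_betw) (auto simp: bij_betw_nth atLeast0LessThan)

text \<open>Every Leibniz term takes one entry from each row in \<open>S\<close>. If the sizes
  differ, the determinant is 0 by convention, and 0 is homogeneous of every degree.\<close>

lemma row_homogeneous_minor:
  fixes R S :: "'n::{finite,linorder} set"
  shows "row_homogeneous (\<Sum>i\<in>S. Poly_Mapping.single i 1) (minor generic_matrix R S)"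
proof (cases "card S = card R")
  case True
  show ?thesis
    unfolding minor_generic_matrix[OF True]
  proof (rule row_homogeneous_sum)
    fix p
    let ?f = "\<Prod>i = 0..<card S. vec_nth (vec_nth generic_matrix (sorted_list_of_set S ! i)) (sorted_list_of_set R ! p i)"
    have "row_homogeneous (\<Sum>i = 0..<card S. Poly_Mapping.single (sorted_list_of_set S ! i) 1) ?f"
      by (intro row_homogeneous_prod row_homogeneous_generic_matrix)
    hence "row_homogeneous (\<Sum>i\<in>S. Poly_Mapping.single i 1) ?f"
      unfolding sum_nth_sorted_list_of_set[of S "\<lambda>i. Poly_Mapping.single i 1", OF finite] .
    thus "row_homogeneous (\<Sum>i\<in>S. Poly_Mapping.single i 1) (of_int (sign p) * ?f)"
      by (cases p rule: sign_cases) (auto intro: row_homogeneous_uminus)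
  qed
next
  case False
  thus ?thesis by (simp add: minor_def Determinant.det_def)
qed

lemma prod_mpoly_var:
  "(\<Prod>i\<in>A. mpoly_var (f i)) = (Poly_Mapping.single (\<Sum>i\<in>A. Poly_Mapping.single (f i) 1) 1 :: ('v, 'a::comm_ring_1) mpoly)"
  by (induction A rule: infinite_finite_induct) (auto simp: mpoly_var_def mult_single)

text \<open>The diagonal monomial occurs in the Leibniz expansion for the identity permutation only.\<close>

lemma minor_generic_matrix_nonzero:
  fixes R S :: "'n::{finite,linorder} set"
  assumes "comp_le S R"
  shows "minor generic_matrix R S \<noteq> 0"
proof -
  let ?s = "\<lambda>i. sorted_list_of_set S ! i" and ?r = "\<lambda>i. sorted_list_of_set R ! i"
  let ?n = "card S"
  have card: "card S = card R" and le: "\<And>i. i < ?n \<Longrightarrow> ?s i \<le> ?r i"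
    using assms by (auto simp: comp_le_def)
  define mon where "mon p = (\<Sum>i = 0..<?n. Poly_Mapping.single (?s i, ?r (p i)) (1::nat))" for p
  define trm where "trm p = (\<Prod>i = 0..<?n. vec_nth (vec_nth generic_matrix (?s i)) (?r (p i)))" for p :: "nat \<Rightarrow> nat"
  \<comment> \<open>A Leibniz product is a single monomial, or 0 as soon as it uses an entry below
    the diagonal.\<close>
  have trm: "trm p = Poly_Mapping.single (mon p) 1 \<or> trm p = 0" for p
  proof (cases "\<forall>i<?n. ?s i \<le> ?r (p i)")
    case True
    hence "trm p = (\<Prod>i = 0..<?n. mpoly_var (?s i, ?r (p i)))"
      unfolding trm_def by (intro prod.cong) (auto simp: generic_matrix_def)
    thus ?thesis by (simp add: prod_mpoly_var mon_def)
  next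
    case False
    then obtain i where "i < ?n" "\<not> ?s i \<le> ?r (p i)" by auto
    hence "trm p = 0"
      unfolding trm_def by (intro prod_zero bexI[of _ i]) (auto simp: generic_matrix_def)
    thus ?thesis ..
  qed
  have trm_id: "trm id = Poly_Mapping.single (mon id) 1"
  proof -
    have "trm id = (\<Prod>i = 0..<?n. mpoly_var (?s i, ?r (id i)))"
      unfolding trm_def using le by (intro prod.cong) (auto simp: generic_matrix_def)
    thus ?thesis by (simp add: prod_mpoly_var mon_def)
  qed
  \<comment> \<open>A permutation moving \<open>i\<close> uses the variable in row
    \<open>?s i\<close> and column \<open>?r (p i)\<close>, which is absent from the diagonal
    monomial.\<close>
  have mon_ne: "mon p \<noteq> mon id" if p: "p permutes {0..<?n}" "p \<noteq> id" for p
  proof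
    assume eq: "mon p = mon id"
    obtain i where i: "p i \<noteq> i" using p(2) by (metis ext id_apply)
    hence "i < ?n" using p(1) by (auto simp: permutes_def)
    hence "p i < ?n" using permutes_in_image[OF p(1), of i] by simp
    have "Poly_Mapping.lookup (mon id) (?s i, ?r (p i)) = 0"
      unfolding mon_def lookup_sum
    proof (intro sum.neutral ballI)
      fix q assume "q \<in> {0..<?n}"
      hence "\<not> (?s q = ?s i \<and> ?r q = ?r (p i))"
        using i \<open>i < ?n\<close> \<open>p i < ?n\<close> card by (auto simp: nth_eq_iff_index_eq)
      thus "Poly_Mapping.lookup (Poly_Mapping.single (?s q, ?r (id q)) 1) (?s i, ?r (p i)) = 0"
        by (auto simp: lookup_single when_def)
    qed
    moreover have "Poly_Mapping.lookup (mon p) (?s i, ?r (p i)) \<ge>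
        (\<Sum>q\<in>{i}. Poly_Mapping.lookup (Poly_Mapping.single (?s q, ?r (p q)) (1::nat)) (?s i, ?r (p i)))"
      unfolding mon_def lookup_sum using \<open>i < ?n\<close> by (intro sum_mono2) auto
    ultimately show False using eq by simp
  qed
  have "Poly_Mapping.lookup (minor generic_matrix R S) (mon id) =
      (\<Sum>p | p permutes {0..<?n}. Poly_Mapping.lookup (of_int (sign p) * trm p) (mon id))"
    unfolding minor_generic_matrix[OF card] trm_def lookup_sum ..
  also have "\<dots> = (\<Sum>p | p permutes {0..<?n}. if p = id then 1 else 0)"
  proof (rule sum.cong)
    fix p assume p: "p \<in> {p. p permutes {0..<?n}}"
    show "Poly_Mapping.lookup (of_int (sign p) * trm p) (mon id) = (if p = id then 1 else 0)"
    proof (cases "p = id")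
      case True
      thus ?thesis by (simp add: trm_id)
    next
      case False
      hence "Poly_Mapping.lookup (trm p) (mon id) = 0"
        using trm[of p] mon_ne[of p] p by (auto simp: lookup_single when_def)
      thus ?thesis using False by (cases p rule: sign_cases) auto
    qed
  qed simp
  also have "\<dots> = 1" by (simp add: permutes_id finite_permutations)
  finally show ?thesis by auto
qed

section \<open>The torus action and the dual character\<close>

lemma matrix_inv_diag_matrix:
  fixes x :: "'n::finite \<Rightarrow> complex"
  assumes "\<forall>i. x i \<noteq> 0"
  shows "matrix_inv (diag_matrix (\<lambda>i. inverse (x i))) = diag_matrix x"
proof -
  have mult: "diag_matrix a ** diag_matrix b = diag_matrix (\<lambda>i. a i * b i)" for a b :: "'n \<Rightarrow> complex"
  proof -
    have "(\<Sum>k\<in>UNIV. (if i = k then a i else 0) * (if k = j then b k else 0)) = (if i = j then a i * b i else 0)" for i j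
    proof -
      have "(\<Sum>k\<in>UNIV. (if i = k then a i else 0) * (if k = j then b k else 0)) =
         (\<Sum>k\<in>UNIV. if k = i then (if i = j then a i * b i else 0) else 0)"
        by (intro sum.cong) auto
      thus ?thesis by simp
    qed
    thus ?thesis by (simp add: matrix_matrix_mult_def diag_matrix_def vec_eq_iff)
  qed
  have one: "diag_matrix (\<lambda>i. 1) = (Finite_Cartesian_Product.mat 1 :: complex ^ 'n ^ 'n)"
    by (simp add: diag_matrix_def Finite_Cartesian_Product.mat_def vec_eq_iff)
  let ?A = "diag_matrix (\<lambda>i. inverse (x i))" and ?B = "diag_matrix x"
  have AB: "?A ** ?B = Finite_Cartesian_Product.mat 1" "?B ** ?A = Finite_Cartesian_Product.mat 1"
    using assms by (simp_all add: mult one)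
  \<comment> \<open>\<open>matrix_inv\<close> is a choice, so only its defining property is
    available; multiplying by \<open>?B\<close> on the left identifies it.\<close>
  hence "?A ** matrix_inv ?A = Finite_Cartesian_Product.mat 1"
    unfolding matrix_inv_def by (rule_tac someI2[of _ ?B]) auto
  hence "?B ** (?A ** matrix_inv ?A) = ?B" by simp
  thus ?thesis by (simp add: matrix_mul_assoc AB)
qed

lemma single_power: "(Poly_Mapping.single (Poly_Mapping.single v 1) c :: ('v, 'a::comm_semiring_1) mpoly) ^ k =
   Poly_Mapping.single (Poly_Mapping.single v k) (c ^ k)"
  by (induction k) (auto simp: mult_single single_add[symmetric] simp flip: single_one)

lemma prod_single:
  "(\<Prod>i\<in>A. Poly_Mapping.single (a i) (c i)) = (Poly_Mapping.single (\<Sum>i\<in>A. a i) (\<Prod>i\<in>A. c i) :: ('v, 'a::comm_semiring_1) mpoly)"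
  by (induction A rule: infinite_finite_induct) (auto simp: mult_single)

text \<open>The inverse in the action cancels the inverse entries, so the variable in row
  \<open>i\<close> is multiplied by \<open>x i\<close> and every monomial is an eigenvector.\<close>

lemma lookup_borel_act_diag:
  fixes f :: "'n::{finite,linorder} ypoly"
  assumes x: "\<forall>i. x i \<noteq> 0" and f: "upper_poly f"
  shows "Poly_Mapping.lookup (borel_act f (diag_matrix (\<lambda>i. inverse (x i)))) m =
    Poly_Mapping.lookup f m * monomial_value x (row_degree m)"
proof -
  let ?g = "\<lambda>(i, j). vec_nth (vec_nth (map_matrix mpoly_const (diag_matrix x) ** generic_matrix) i) j"
  have g: "?g v = Poly_Mapping.single (Poly_Mapping.single v 1) (x (fst v))" if "fst v \<le> snd v" for v :: "'n \<times> 'n"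
  proof -
    obtain i j where v: "v = (i, j)" by (cases v)
    have "?g v = (\<Sum>k\<in>UNIV. mpoly_const (if i = k then x i else 0) * vec_nth (vec_nth generic_matrix k) j)"
      by (simp add: v matrix_matrix_mult_def diag_matrix_def map_matrix_def)
    also have "\<dots> = (\<Sum>k\<in>UNIV. if k = i then mpoly_const (x i) * vec_nth (vec_nth generic_matrix i) j else 0)"
      by (intro sum.cong) (auto simp: mpoly_const_def)
    also have "\<dots> = mpoly_const (x i) * mpoly_var (i, j)"
      using that v by (simp add: generic_matrix_def)
    also have "\<dots> = Poly_Mapping.single (Poly_Mapping.single v 1) (x (fst v))"
      by (simp add: v mpoly_const_def mpoly_var_def mult_single)
    finally show ?thesis .
  qed
  have mon: "mpoly_const c * (\<Prod>v\<in>Poly_Mapping.keys m. ?g v ^ Poly_Mapping.lookup m v) =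
      Poly_Mapping.single m (c * monomial_value x (row_degree m))" if "upper_monomial m" for m c
  proof -
    have "(\<Prod>v\<in>Poly_Mapping.keys m. ?g v ^ Poly_Mapping.lookup m v) =
       (\<Prod>v\<in>Poly_Mapping.keys m. Poly_Mapping.single (Poly_Mapping.single v (Poly_Mapping.lookup m v)) (x (fst v) ^ Poly_Mapping.lookup m v))"
      using that by (intro prod.cong refl) (simp only: g single_power upper_monomial_def)
    also have "\<dots> = Poly_Mapping.single m (monomial_value x (row_degree m))"
      unfolding prod_single sum_single_lookup monomial_value_row_degree ..
    finally show ?thesis by (simp add: mpoly_const_def mult_single)
  qed
  have "borel_act f (diag_matrix (\<lambda>i. inverse (x i))) =
      (\<Sum>m\<in>Poly_Mapping.keys f. Poly_Mapping.single m (Poly_Mapping.lookup f m * monomial_value x (row_degree m)))"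
    unfolding borel_act_def mpoly_eval_def matrix_inv_diag_matrix[OF x]
    using f by (intro sum.cong refl mon) (auto simp: upper_poly_def)
  thus ?thesis by (auto simp: lookup_sum lookup_single when_def in_keys_iff)
qed

definition diagram_weight :: "nat \<Rightarrow> ('n::finite \<times> nat) set \<Rightarrow> ('n \<Rightarrow>\<^sub>0 nat)" where
  "diagram_weight k C = (\<Sum>j\<in>{1..k}. \<Sum>i\<in>column C j. Poly_Mapping.single i 1)"

text \<open>A basis chosen among the spanning products consists of weight vectors, so the trace is a
  sum of monomials with positive multiplicities. No weight of a discarded product is lost, because
  that product is nonzero and expands in the basis.\<close>

lemma keys_dual_character:
  fixes D :: "('n::{finite,linorder} \<times> nat) set"
  shows "Poly_Mapping.keys (dual_character k D) = diagram_weight k ` {C. is_diagram k C \<and> diagram_le k C D}"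
proof -
  define \<C> where "\<C> = {C :: ('n \<times> nat) set. is_diagram k C \<and> diagram_le k C D}"
  define gen where "gen C = (\<Prod>j\<in>{1..k}. minor generic_matrix (column D j) (column C j))" for C
  have fin: "finite \<C>"
    by (rule finite_subset[of _ "Pow (UNIV \<times> {1..k})"]) (auto simp: \<C>_def is_diagram_def)
  define V where "V = flagged_weyl_module k D"
  have V: "V = mpoly.span (gen ` \<C>)"
    unfolding V_def flagged_weyl_module_def gen_def \<C>_def by (rule arg_cong[of _ _ mpoly.span]) auto
  have gen0: "gen C \<noteq> 0" if "C \<in> \<C>" for C
    unfolding gen_def using that
    by (intro mpoly_prod_nonzero minor_generic_matrix_nonzero) (auto simp: \<C>_def diagram_le_def)
  have hom: "row_homogeneous (diagram_weight k C) (gen C)" for C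
    unfolding gen_def diagram_weight_def by (intro row_homogeneous_prod row_homogeneous_minor)
  obtain B where B: "B \<subseteq> gen ` \<C>" "mpoly.independent B" "gen ` \<C> \<subseteq> mpoly.span B"
    using mpoly.maximal_independent_subset[of "gen ` \<C>"] by blast
  have finB: "finite B" using B fin finite_subset by blast
  have spanB: "mpoly.span B = V"
    unfolding V using B by (metis mpoly.span_mono mpoly.span_minimal mpoly.subspace_span subset_antisym)
  have "\<forall>b\<in>B. \<exists>C\<in>\<C>. b = gen C" using B by auto
  \<comment> \<open>Different diagrams may give the same product, so one diagram is selected for
    each basis vector.\<close>
  then obtain diag where diag: "\<And>b. b \<in> B \<Longrightarrow> diag b \<in> \<C>" "\<And>b. b \<in> B \<Longrightarrow> b = gen (diag b)"
    by metis
  define \<alpha> where "\<alpha> b = diagram_weight k (diag b)" for b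
  have homB: "row_homogeneous (\<alpha> b) b" if "b \<in> B" for b
    using hom[of "diag b"] diag(2)[OF that] by (simp add: \<alpha>_def)
  have upper: "upper_poly v" if "v \<in> V" for v
  proof -
    have "gen ` \<C> \<subseteq> {p. upper_poly p}" using hom by (auto simp: upper_poly_def row_homogeneous_def)
    from mpoly.span_minimal[OF this subspace_upper_poly] that show ?thesis by (auto simp: V)
  qed
  have trace: "trace_on mpoly_scale V (\<lambda>f. borel_act f (diag_matrix (\<lambda>i. inverse (x i)))) =
      (\<Sum>b\<in>B. monomial_value x (\<alpha> b))" if x: "\<forall>i. x i \<noteq> 0" for x
    unfolding spanB[symmetric]
  proof (rule mpoly.trace_on_eigenbasis[OF B(2) finB])
    fix b assume b: "b \<in> B"
    hence "upper_poly b" using upper spanB mpoly.span_base by blast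
    note lookup = lookup_borel_act_diag[OF x this]
    show "borel_act b (diag_matrix (\<lambda>i. inverse (x i))) = mpoly_scale (monomial_value x (\<alpha> b)) b"
    proof (rule poly_mapping_eqI)
      fix m
      show "Poly_Mapping.lookup (borel_act b (diag_matrix (\<lambda>i. inverse (x i)))) m =
          Poly_Mapping.lookup (mpoly_scale (monomial_value x (\<alpha> b)) b) m"
        using homB[OF b]
        by (cases "m \<in> Poly_Mapping.keys b")
          (auto simp: lookup lookup_mpoly_scale row_homogeneous_def not_in_keys_iff_lookup_eq_zero)
    qed
  next
    fix u v assume uv: "u \<in> mpoly.span B" "v \<in> mpoly.span B"
    hence "u + v \<in> mpoly.span B" by (rule mpoly.span_add)
    with uv show "borel_act (u + v) (diag_matrix (\<lambda>i. inverse (x i))) =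
       borel_act u (diag_matrix (\<lambda>i. inverse (x i))) + borel_act v (diag_matrix (\<lambda>i. inverse (x i)))"
      using upper unfolding spanB
      by (intro poly_mapping_eqI) (auto simp: lookup_borel_act_diag[OF x] lookup_add distrib_right)
  next
    fix c v assume v: "v \<in> mpoly.span B"
    hence "mpoly_scale c v \<in> mpoly.span B" by (rule mpoly.span_scale)
    with v show "borel_act (mpoly_scale c v) (diag_matrix (\<lambda>i. inverse (x i))) =
       mpoly_scale c (borel_act v (diag_matrix (\<lambda>i. inverse (x i))))"
      using upper unfolding spanB
      by (intro poly_mapping_eqI) (auto simp: lookup_borel_act_diag[OF x] lookup_mpoly_scale)
  qed
  define p where "p = (\<Sum>b\<in>B. Poly_Mapping.single (\<alpha> b) (1::complex))"
  \<comment> \<open>The coefficients are cardinalities, so no cancellation can remove a weight from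
    the support.\<close>
  have lookup_p: "Poly_Mapping.lookup p m = of_nat (card {b\<in>B. \<alpha> b = m})" for m
    using finB by (simp add: p_def lookup_sum lookup_single when_def sum.If_cases Int_def)
  have keys_p: "Poly_Mapping.keys p = \<alpha> ` B"
    using finB by (auto simp: in_keys_iff lookup_p)
  have eval_p: "mpoly_eval (\<lambda>c. c) x p = (\<Sum>b\<in>B. monomial_value x (\<alpha> b))" for x
  proof -
    have "mpoly_eval (\<lambda>c. c) x p = (\<Sum>m\<in>\<alpha> ` B. Poly_Mapping.lookup p m * monomial_value x m)"
      using finB by (intro mpoly_eval_superset) (auto simp: keys_p)
    also have "\<dots> = (\<Sum>m\<in>\<alpha> ` B. \<Sum>b\<in>{b\<in>B. \<alpha> b = m}. monomial_value x (\<alpha> b))"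
      by (intro sum.cong) (auto simp: lookup_p)
    also have "\<dots> = (\<Sum>b\<in>B. monomial_value x (\<alpha> b))"
      using finB by (rule sum.image_gen[symmetric])
    finally show ?thesis .
  qed
  have "dual_character k D = p"
    unfolding dual_character_def V_def[symmetric]
  proof (rule the_equality)
    show "\<forall>x. (\<forall>i. x i \<noteq> 0) \<longrightarrow> mpoly_eval (\<lambda>c. c) x p =
        trace_on mpoly_scale V (\<lambda>f. borel_act f (diag_matrix (\<lambda>i. inverse (x i))))"
      by (simp add: trace eval_p)
  next
    fix q assume "\<forall>x. (\<forall>i. x i \<noteq> 0) \<longrightarrow> mpoly_eval (\<lambda>c. c) x q =
        trace_on mpoly_scale V (\<lambda>f. borel_act f (diag_matrix (\<lambda>i. inverse (x i))))"
    thus "q = p" by (intro mpoly_eqI_torus) (simp add: trace eval_p)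
  qed
  moreover have "\<alpha> ` B = diagram_weight k ` \<C>"
  proof
    show "\<alpha> ` B \<subseteq> diagram_weight k ` \<C>" using diag by (auto simp: \<alpha>_def)
    show "diagram_weight k ` \<C> \<subseteq> \<alpha> ` B"
    proof
      fix m assume "m \<in> diagram_weight k ` \<C>"
      then obtain C where C: "C \<in> \<C>" "m = diagram_weight k C" by auto
      \<comment> \<open>A monomial of \<open>gen C\<close> must occur in some basis vector, and its
        row degree is the weight of both.\<close>
      obtain y where y: "y \<in> Poly_Mapping.keys (gen C)"
        using gen0[OF C(1)] by (metis keys_eq_empty ex_in_conv)
      have "gen C \<in> mpoly.span B" using B C by auto
      hence "gen C = (\<Sum>b\<in>B. mpoly_scale (mpoly.representation B (gen C) b) b)"
        using mpoly.sum_representation_eq[OF B(2) _ finB] by simp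
      hence "Poly_Mapping.lookup (gen C) y = (\<Sum>b\<in>B. mpoly.representation B (gen C) b * Poly_Mapping.lookup b y)"
        by (metis (no_types, lifting) lookup_sum lookup_mpoly_scale sum.cong)
      with y obtain b where b: "b \<in> B" "Poly_Mapping.lookup b y \<noteq> 0"
        by (metis (no_types, lifting) in_keys_iff mult_zero_right sum.neutral)
      hence "row_degree y = \<alpha> b" using homB by (auto simp: row_homogeneous_def in_keys_iff)
      moreover have "row_degree y = m" using hom[of C] y C by (auto simp: row_homogeneous_def)
      ultimately show "m \<in> \<alpha> ` B" using b by auto
    qed
  qed
  ultimately show ?thesis by (simp add: keys_p \<C>_def)
qed

definition diagram_point :: "nat \<Rightarrow> ('n::finite \<times> nat) set \<Rightarrow> real ^ 'n" where
  "diagram_point k C = (\<chi> i. \<Sum>j\<in>{1..k}. of_bool (i \<in> column C j))"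

lemma schubitope_eq:
  fixes D :: "('n::{finite,linorder} \<times> nat) set"
  shows "schubitope k D = convex hull (diagram_point k ` {C. is_diagram k C \<and> diagram_le k C D})"
proof -
  have "real (Poly_Mapping.lookup (diagram_weight k C) i) = (\<Sum>j\<in>{1..k}. of_bool (i \<in> column C j))" for C and i :: 'n
    by (simp add: diagram_weight_def lookup_sum lookup_single when_def sum.If_cases)
  hence "(\<chi> i. real (Poly_Mapping.lookup (diagram_weight k C) i)) = diagram_point k C" for C :: "('n \<times> nat) set"
    by (simp add: diagram_point_def)
  thus ?thesis by (simp add: schubitope_def newton_polytope_def keys_dual_character image_image)
qed

section \<open>Generalized permutahedra\<close>

text \<open>The new coordinate is the marginal increment of \<open>z\<close>. For \<open>I\<close>
  containing \<open>x\<close>, submodularity of \<open>z\<close> at \<open>I\<close> and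
  \<open>S\<close> says that the increment over \<open>I - {x}\<close> is at least as large.\<close>

lemma submodular_extend:
  assumes "submodular z" and t: "\<And>I. I \<subseteq> S \<Longrightarrow> sum t I \<le> z I" "sum t S = z S"
    and x: "x \<notin> (S :: 'n::finite set)"
    and t': "t' = t(x := z (insert x S) - z S)"
  shows "(\<forall>I\<subseteq>insert x S. sum t' I \<le> z I) \<and> sum t' (insert x S) = z (insert x S)"
proof (intro conjI allI impI)
  have old: "sum t' I = sum t I" if "I \<subseteq> S" for I
    using that x unfolding t' by (intro sum.cong) auto
  show "sum t' (insert x S) = z (insert x S)"
    using x old[of S] t by (simp add: t')
  fix I assume I: "I \<subseteq> insert x S"
  show "sum t' I \<le> z I"
  proof (cases "x \<in> I")
    case True
    define I' where "I' = I - {x}"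
    have I': "I = insert x I'" "x \<notin> I'" "I' \<subseteq> S" using True I by (auto simp: I'_def)
    have "z I + z S \<ge> z (I \<union> S) + z (I \<inter> S)" using assms(1) by (simp add: submodular_def)
    moreover have "I \<union> S = insert x S" "I \<inter> S = I'" using I' x by auto
    moreover have "sum t' I = t' x + sum t' I'" using I' by simp
    ultimately show ?thesis using old[OF I'(3)] t(1)[OF I'(3)] by (simp add: t')
  next
    case False
    hence "I \<subseteq> S" using I by auto
    thus ?thesis using old t by simp
  qed
qed

lemma submodular_extend_many:
  assumes "submodular z" and t: "\<And>I. I \<subseteq> S \<Longrightarrow> sum t I \<le> z I" "sum t S = z S"
    and T: "(T :: 'n::finite set) \<inter> S = {}"
  shows "\<exists>t'. (\<forall>i\<in>S. t' i = t i) \<and> (\<forall>I\<subseteq>S \<union> T. sum t' I \<le> z I) \<and> sum t' (S \<union> T) = z (S \<union> T)"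
  using finite[of T] T
proof (induction T rule: finite_induct)
  case empty
  show ?case using t by (intro exI[of _ t]) auto
next
  case (insert x T)
  then obtain t' where t': "\<forall>i\<in>S. t' i = t i" "\<forall>I\<subseteq>S \<union> T. sum t' I \<le> z I" "sum t' (S \<union> T) = z (S \<union> T)"
    by auto
  have x: "x \<notin> S \<union> T" using insert by auto
  show ?case
    using submodular_extend[OF assms(1) _ t'(3) x refl] t'(1,2) x
    by (intro exI[of _ "t'(x := z (insert x (S \<union> T)) - z (S \<union> T))"]) auto
qed

text \<open>Fill in the coordinates in \<open>J\<close> first, starting from the empty set, and then
  the others. The second stage keeps the values on \<open>J\<close>, so the sum over
  \<open>J\<close> stays equal to \<open>z J\<close>.\<close>

lemma associated_submodular_attained:
  fixes P :: "(real ^ 'n::finite) set"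
  assumes "associated_submodular_function P z"
  shows "\<exists>t\<in>P. (\<Sum>i\<in>J. vec_nth t i) = z J"
proof -
  have z: "submodular z" "z {} = 0"
    and P: "P = {t. (\<forall>I. (\<Sum>i\<in>I. vec_nth t i) \<le> z I) \<and> (\<Sum>i\<in>UNIV. vec_nth t i) = z UNIV}"
    using assms unfolding associated_submodular_function_def by auto
  obtain t1 where t1: "\<forall>I\<subseteq>J. sum t1 I \<le> z I" "sum t1 J = z J"
    using submodular_extend_many[OF z(1), of "{}" "\<lambda>_. 0" J] z(2) by auto
  obtain t2 where t2: "\<forall>i\<in>J. t2 i = t1 i" "\<forall>I. sum t2 I \<le> z I" "sum t2 UNIV = z UNIV"
    using submodular_extend_many[OF z(1), of J t1 "-J"] t1 by auto
  have "(\<chi> i. t2 i) \<in> P" using t2 by (auto simp: P)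
  moreover have "(\<Sum>i\<in>J. vec_nth (\<chi> i. t2 i) i) = z J" using t2(1) t1(2) by simp
  ultimately show ?thesis by blast
qed

section \<open>Schubitopes as generalized permutahedra\<close>

definition total_rank :: "nat \<Rightarrow> ('n::{finite,linorder} \<times> nat) set \<Rightarrow> 'n set \<Rightarrow> real" where
  "total_rank k D J = (\<Sum>j\<in>{1..k}. schubert_rank (column D j) J)"

lemma diagram_le_iff:
  "diagram_le k C D \<longleftrightarrow> (\<forall>j\<in>{1..k}. column C j \<in> schubert_bases (column D j))"
  by (simp add: diagram_le_def schubert_bases_def)

lemma sum_diagram_point:
  "(\<Sum>i\<in>J. vec_nth (diagram_point k C) i) = (\<Sum>j\<in>{1..k}. real (card (J \<inter> column C j)))"
proof -
  have "(\<Sum>i\<in>J. vec_nth (diagram_point k C) i) = (\<Sum>j\<in>{1..k}. \<Sum>i\<in>J. of_bool (i \<in> column C j))"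
    unfolding diagram_point_def vec_lambda_beta by (rule sum.swap)
  also have "\<dots> = (\<Sum>j\<in>{1..k}. real (card (J \<inter> column C j)))"
    by (simp add: of_bool_def sum.If_cases)
  finally show ?thesis .
qed

lemma sum_diagram_point_le:
  "diagram_le k C D \<Longrightarrow> (\<Sum>i\<in>J. vec_nth (diagram_point k C) i) \<le> total_rank k D J"
  unfolding sum_diagram_point total_rank_def schubert_rank_def diagram_le_iff
  by (intro sum_mono) (simp add: rank_from_bases_ge)

lemma sum_diagram_point_UNIV:
  "diagram_le k C D \<Longrightarrow> (\<Sum>i\<in>UNIV. vec_nth (diagram_point k C) i) = total_rank k D UNIV"
  unfolding sum_diagram_point total_rank_def schubert_rank_def diagram_le_iff
  by (intro sum.cong) (simp_all add: rank_UNIV schubert_bases_iff)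

text \<open>The greedy base depends on the order of the ground set, and the same order serves all
  columns, so their contributions are extremal simultaneously.\<close>

lemma greedy_diagram:
  fixes D :: "('n::{finite,linorder} \<times> nat) set"
  assumes "distinct xs" "set xs = UNIV"
  shows "\<exists>C. is_diagram k C \<and> diagram_le k C D \<and>
    (\<forall>m. (\<Sum>i\<in>set (take m xs). vec_nth (diagram_point k C) i) = total_rank k D (set (take m xs)))"
proof -
  have "\<forall>j. \<exists>B. B \<in> schubert_bases (column D j) \<and>
      (\<forall>m. card (set (take m xs) \<inter> B) = rank_from_bases (schubert_bases (column D j)) (set (take m xs)))"
    using greedy_base[OF assms] by blast
  then obtain B where B: "\<And>j. B j \<in> schubert_bases (column D j)"
    "\<And>j m. card (set (take m xs) \<inter> B j) = rank_from_bases (schubert_bases (column D j)) (set (take m xs))"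
    by metis
  define C where "C = {(i, j). j \<in> {1..k} \<and> i \<in> B j}"
  have col: "column C j = B j" if "j \<in> {1..k}" for j using that by (auto simp: C_def column_def)
  have "is_diagram k C" by (auto simp: C_def is_diagram_def)
  moreover have "diagram_le k C D" by (simp add: diagram_le_iff col B)
  moreover have "(\<Sum>i\<in>set (take m xs). vec_nth (diagram_point k C) i) = total_rank k D (set (take m xs))" for m
    unfolding sum_diagram_point total_rank_def schubert_rank_def by (simp add: col B)
  ultimately show ?thesis by blast
qed

lemma sum_coordinates_eq_inner:
  "(\<Sum>i\<in>J. vec_nth t i) = inner (\<chi> i. of_bool (i \<in> J)) (t :: real ^ 'n::finite)"
  by (simp add: inner_vec_def of_bool_def if_distrib[of "\<lambda>c. c * _"] sum.If_cases cong: if_cong)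

text \<open>This is summation by parts in inductive form: replace all weights by the last one, then
  that one by \<open>c\<close>. Nonnegative prefix sums make both replacements increase the
  sum.\<close>

lemma sum_list_weighted_le:
  fixes f d :: "'a \<Rightarrow> real"
  assumes "sorted_wrt (\<lambda>x y. f x \<le> f y) xs" "\<And>m. 0 \<le> sum_list (map d (take m xs))"
    "\<And>y. y \<in> set xs \<Longrightarrow> f y \<le> c"
  shows "sum_list (map (\<lambda>x. f x * d x) xs) \<le> c * sum_list (map d xs)"
  using assms
proof (induction xs arbitrary: c rule: rev_induct)
  case (snoc x xs)
  have "0 \<le> sum_list (map d (take m xs))" for m
    using snoc.prems(2)[of "min m (length xs)"] by (cases "m \<le> length xs") auto
  hence "sum_list (map (\<lambda>x. f x * d x) xs) \<le> f x * sum_list (map d xs)"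
    using snoc.prems(1) by (intro snoc.IH) (auto simp: sorted_wrt_append)
  hence "sum_list (map (\<lambda>x. f x * d x) (xs @ [x])) \<le> f x * sum_list (map d (xs @ [x]))"
    by (simp add: distrib_left)
  also have "\<dots> \<le> c * sum_list (map d (xs @ [x]))"
    using snoc.prems(2)[of "Suc (length xs)"] snoc.prems(3)[of x] by (intro mult_right_mono) auto
  finally show ?case .
qed simp

text \<open>All generating points satisfy the inequalities. For the converse, a point
  \<open>t\<close> outside the hull is separated from it by some \<open>a\<close>, while a greedy
  point shows that \<open>a\<close> takes on the hull a value no larger than at
  \<open>t\<close>.\<close>

lemma schubitope_halfspaces:
  fixes D :: "('n::{finite,linorder} \<times> nat) set"
  shows "schubitope k D = {t. (\<forall>I. (\<Sum>i\<in>I. vec_nth t i) \<le> total_rank k D I) \<and>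
     (\<Sum>i\<in>UNIV. vec_nth t i) = total_rank k D UNIV}" (is "_ = ?P")
proof
  define H where "H = diagram_point k ` {C. is_diagram k C \<and> diagram_le k C D}"
  have hull: "schubitope k D = convex hull H" by (simp add: schubitope_eq H_def)
  have "convex ?P"
  proof -
    have "?P = (\<Inter>I. {t. inner (\<chi> i. of_bool (i \<in> I)) t \<le> total_rank k D I}) \<inter>
        {t. inner (\<chi> i. of_bool (i \<in> UNIV)) t = total_rank k D UNIV}"
      unfolding sum_coordinates_eq_inner by auto
    also have "convex \<dots>"
      by (intro convex_Int convex_INT convex_halfspace_le convex_hyperplane)
    finally show ?thesis .
  qed
  moreover have "H \<subseteq> ?P"
    using sum_diagram_point_le[of k _ D] sum_diagram_point_UNIV[of k _ D] by (auto simp: H_def)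
  ultimately show "schubitope k D \<subseteq> ?P" unfolding hull by (rule hull_minimal[rotated])
  show "?P \<subseteq> schubitope k D"
  proof (rule subsetI, rule ccontr)
    fix t assume t: "t \<in> ?P" "t \<notin> schubitope k D"
    have "finite {C :: ('n \<times> nat) set. is_diagram k C \<and> diagram_le k C D}"
      by (rule finite_subset[of _ "Pow (UNIV \<times> {1..k})"]) (auto simp: is_diagram_def)
    hence "closed (convex hull H)"
      by (simp add: H_def compact_imp_closed finite_imp_compact_convex_hull)
    then obtain a b where ab: "inner a t < b" "\<And>p. p \<in> schubitope k D \<Longrightarrow> b < inner a p"
      using separating_hyperplane_closed_point[of "convex hull H" t] t(2) unfolding hull by auto
    \<comment> \<open>The separating functional is larger on the hull than at \<open>t\<close>.
      Sorting by increasing coefficients lets the greedy point put as much mass as possible where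
      \<open>a\<close> is small, which minimises \<open>a\<close>.\<close>
    define xs where "xs = sort_key (\<lambda>i. vec_nth a i) (sorted_list_of_set UNIV)"
    have "sorted (map (\<lambda>i. vec_nth a i) xs)" unfolding xs_def by (rule sorted_sort_key)
    hence xs: "distinct xs" "set xs = UNIV" "sorted_wrt (\<lambda>x y. vec_nth a x \<le> vec_nth a y) xs"
      unfolding sorted_map by (simp_all add: xs_def)
    obtain C where C: "is_diagram k C" "diagram_le k C D"
      "\<And>m. (\<Sum>i\<in>set (take m xs). vec_nth (diagram_point k C) i) = total_rank k D (set (take m xs))"
      using greedy_diagram[OF xs(1,2)] by blast
    define p where "p = diagram_point k C"
    have p: "p \<in> schubitope k D" unfolding hull p_def H_def using C by (intro hull_inc) auto
    define d where "d i = vec_nth p i - vec_nth t i" for i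
    have sum_d: "sum_list (map d (take m xs)) = total_rank k D (set (take m xs)) - (\<Sum>i\<in>set (take m xs). vec_nth t i)" for m
      using xs(1) C(3)[of m] by (simp add: sum_list_distinct_conv_sum_set d_def sum_subtractf p_def)
    have "sum_list (map d xs) = 0"
      using sum_d[of "length xs"] xs(2) t(1) by simp
    \<comment> \<open>The maximum only serves as a common bound on the weights; it is multiplied by
      the total difference, which is 0.\<close>
    moreover have "sum_list (map (\<lambda>i. vec_nth a i * d i) xs) \<le> Max (range (vec_nth a)) * sum_list (map d xs)"
      using sum_d t(1) by (intro sum_list_weighted_le xs(3)) auto
    ultimately have "(\<Sum>i\<in>UNIV. vec_nth a i * d i) \<le> 0"
      using xs(1,2) by (simp add: sum_list_distinct_conv_sum_set)
    hence "inner a p \<le> inner a t"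
      by (simp add: inner_vec_def d_def right_diff_distrib sum_subtractf)
    thus False using ab(1) ab(2)[OF p] by simp
  qed
qed

lemma schubitope_sum_le: "t \<in> schubitope k D \<Longrightarrow> (\<Sum>i\<in>J. vec_nth t i) \<le> total_rank k D J"
  by (simp add: schubitope_halfspaces)

lemma total_rank_attained:
  fixes D :: "('n::{finite,linorder} \<times> nat) set"
  shows "\<exists>t\<in>schubitope k D. (\<Sum>i\<in>J. vec_nth t i) = total_rank k D J"
proof -
  define xs where "xs = sorted_list_of_set J @ sorted_list_of_set (-J)"
  have xs: "distinct xs" "set xs = UNIV" "set (take (card J) xs) = J" by (auto simp: xs_def)
  obtain C where "is_diagram k C" "diagram_le k C D"
    "(\<Sum>i\<in>J. vec_nth (diagram_point k C) i) = total_rank k D J"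
    using greedy_diagram[OF xs(1,2), of k D] xs(3) by metis
  thus ?thesis unfolding schubitope_eq by (blast intro: hull_inc)
qed

text \<open>A bound attained at each \<open>J\<close> is the maximum of the corresponding linear
  functional, hence determined by the polytope alone.\<close>

lemma total_rank_eqI:
  fixes D :: "('n::{finite,linorder} \<times> nat) set"
  assumes "\<And>t J. t \<in> schubitope k D \<Longrightarrow> (\<Sum>i\<in>J. vec_nth t i) \<le> z J"
    and "\<And>J. \<exists>t\<in>schubitope k D. (\<Sum>i\<in>J. vec_nth t i) = z J"
  shows "z = total_rank k D"
proof
  fix J
  obtain t t' where "t \<in> schubitope k D" "(\<Sum>i\<in>J. vec_nth t i) = z J"
      "t' \<in> schubitope k D" "(\<Sum>i\<in>J. vec_nth t' i) = total_rank k D J"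
    using assms(2)[of J] total_rank_attained[of k D J] by blast
  thus "z J = total_rank k D J" using assms(1)[of t' J] schubitope_sum_le[of t k D J] by simp
qed

lemma schubitope_eq_iff_total_rank_eq:
  fixes D D' :: "('n::{finite,linorder} \<times> nat) set"
  shows "schubitope k D = schubitope k' D' \<longleftrightarrow> total_rank k D = total_rank k' D'"
proof
  assume eq: "schubitope k D = schubitope k' D'"
  show "total_rank k D = total_rank k' D'"
    by (rule total_rank_eqI) (use total_rank_attained[of k D] in \<open>simp_all add: schubitope_sum_le flip: eq\<close>)
qed (simp add: schubitope_halfspaces)

section \<open>Recovering the columns from the Schubitope\<close>

definition column_count :: "nat \<Rightarrow> ('n \<times> nat) set \<Rightarrow> 'n set \<Rightarrow> nat" where
  "column_count k D I = card {j\<in>{1..k}. column D j = I}"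

lemma total_rank_eq_sum_column_count:
  "total_rank k D J = (\<Sum>I\<in>UNIV. real (column_count k D I) * schubert_rank I J)"
proof -
  have "total_rank k D J = (\<Sum>I\<in>UNIV. \<Sum>j\<in>{j\<in>{1..k}. column D j = I}. schubert_rank (column D j) J)"
    unfolding total_rank_def by (subst sum.group) auto
  also have "\<dots> = (\<Sum>I\<in>UNIV. real (column_count k D I) * schubert_rank I J)"
    by (intro sum.cong) (auto simp: column_count_def)
  finally show ?thesis .
qed

lemma sum_column_count: "(\<Sum>I\<in>UNIV. column_count k D I) = k"
  for D :: "('n::finite \<times> nat) set"
proof -
  have "(\<Sum>I\<in>UNIV. \<Sum>j\<in>{j\<in>{1..k}. column D j = I}. 1) = (\<Sum>j\<in>{1..k}. 1 :: nat)"
    by (rule sum.group) auto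
  thus ?thesis by (simp add: column_count_def)
qed

text \<open>Linear independence gives the multiplicities of all nonempty columns. Empty columns are
  invisible to the rank functions; their number follows because both diagrams have \<open>k\<close>
  columns.\<close>

lemma column_count_eq_if_total_rank_eq:
  fixes D D' :: "('n::{finite,linorder} \<times> nat) set"
  assumes "total_rank k D = total_rank k D'"
  shows "column_count k D = column_count k D'"
proof -
  define c where "c I = (if I = {} then 0 else real (column_count k D I) - real (column_count k D' I))" for I
  have "(\<Sum>I\<in>UNIV. c I * schubert_rank I J) = 0" for J
  proof -
    have "(\<Sum>I\<in>UNIV. c I * schubert_rank I J) =
        (\<Sum>I\<in>UNIV. real (column_count k D I) * schubert_rank I J - real (column_count k D' I) * schubert_rank I J)"
      by (intro sum.cong) (auto simp: c_def left_diff_distrib)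
    also have "\<dots> = total_rank k D J - total_rank k D' J"
      unfolding total_rank_eq_sum_column_count sum_subtractf ..
    finally show ?thesis by (simp add: assms)
  qed
  from schubert_rank_independent[of c, OF this] have "c I = 0" for I by (simp add: c_def)
  hence ne: "column_count k D I = column_count k D' I" if "I \<noteq> {}" for I
    using that by (metis c_def eq_iff_diff_eq_0 of_nat_eq_iff)
  have "k = column_count k E {} + (\<Sum>I\<in>UNIV - {{}}. column_count k E I)" for E :: "('n \<times> nat) set"
    using sum_column_count[of k E] sum.remove[of UNIV "{}" "column_count k E"] by simp
  from this[of D] this[of D'] have "column_count k D {} = column_count k D' {}"
    using ne by simp
  thus ?thesis using ne by (metis ext)
qed

text \<open>Equal multiplicities mean equal multisets of columns, and these differ by a relabelling
  of \<open>{1..k}\<close>. Conversely, a permutation only reorders the sum of rank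
  functions.\<close>

lemma column_permutation_iff:
  fixes D D' :: "('n::{finite,linorder} \<times> nat) set"
  assumes D: "is_diagram k D" and D': "is_diagram k D'"
  shows "schubitope k D = schubitope k D' \<longleftrightarrow>
    (\<exists>\<sigma>. \<sigma> permutes {1..k} \<and> D = {(i, \<sigma> j) | i j. (i, j) \<in> D'})"
proof
  assume "schubitope k D = schubitope k D'"
  hence eq: "column_count k D = column_count k D'"
    unfolding schubitope_eq_iff_total_rank_eq by (rule column_count_eq_if_total_rank_eq)
  have "count (image_mset (column E) (mset_set {1..k})) I = column_count k E I" for E :: "('n \<times> nat) set" and I
    by (simp add: column_count_def count_image_mset_eq_card_vimage)
  hence "image_mset (column D') (mset_set {1..k}) = image_mset (column D) (mset_set {1..k})"
    by (intro multiset_eqI) (simp only: eq)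
  then obtain \<sigma> where \<sigma>: "\<sigma> permutes {1..k}" and "\<forall>j\<in>{1..k}. column D' j = column D (\<sigma> j)"
    by (rule image_mset_eq_implies_permutes[OF finite_atLeastAtMost])
  hence col: "\<And>j. j \<in> {1..k} \<Longrightarrow> column D' j = column D (\<sigma> j)" by blast
  \<comment> \<open>Equality of columns is known only for indices in \<open>{1..k}\<close>; the
    diagram hypotheses exclude cells elsewhere.\<close>
  have "(i, l) \<in> D \<longleftrightarrow> (\<exists>j. l = \<sigma> j \<and> (i, j) \<in> D')" for i l
  proof
    assume il: "(i, l) \<in> D"
    hence "l \<in> \<sigma> ` {1..k}" using D permutes_image[OF \<sigma>] by (auto simp: is_diagram_def)
    then obtain j where j: "j \<in> {1..k}" "l = \<sigma> j" by blast
    thus "\<exists>j. l = \<sigma> j \<and> (i, j) \<in> D'" using il col[OF j(1)] by (auto simp: column_def)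
  next
    assume "\<exists>j. l = \<sigma> j \<and> (i, j) \<in> D'"
    then obtain j where j: "l = \<sigma> j" "(i, j) \<in> D'" by blast
    hence "j \<in> {1..k}" using D' by (auto simp: is_diagram_def)
    thus "(i, l) \<in> D" using j col[of j] by (auto simp: column_def)
  qed
  hence "D = {(i, \<sigma> j) | i j. (i, j) \<in> D'}" by auto
  with \<sigma> show "\<exists>\<sigma>. \<sigma> permutes {1..k} \<and> D = {(i, \<sigma> j) | i j. (i, j) \<in> D'}" by blast
next
  assume "\<exists>\<sigma>. \<sigma> permutes {1..k} \<and> D = {(i, \<sigma> j) | i j. (i, j) \<in> D'}"
  then obtain \<sigma> where \<sigma>: "\<sigma> permutes {1..k}" and eq: "D = {(i, \<sigma> j) | i j. (i, j) \<in> D'}" by blast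
  have "column D (\<sigma> j) = column D' j" for j
    using permutes_inj[OF \<sigma>] by (auto simp: eq column_def dest: injD)
  hence "total_rank k D J = total_rank k D' J" for J
    unfolding total_rank_def by (subst sum.permute[OF \<sigma>]) (simp add: o_def)
  thus "schubitope k D = schubitope k D'"
    by (simp add: schubitope_eq_iff_total_rank_eq fun_eq_iff)
qed

lemma sum_list_concat_replicate:
  fixes f :: "'a \<Rightarrow> real"
  shows "sum_list (map f (concat (map (\<lambda>x. replicate (c x) x) xs))) = (\<Sum>x\<leftarrow>xs. real (c x) * f x)"
  by (induction xs) (auto simp: sum_list_replicate)

text \<open>Take \<open>c I\<close> copies of each set \<open>I\<close> as columns.\<close>

lemma diagram_with_total_rank:
  fixes c :: "'n::{finite,linorder} set \<Rightarrow> nat"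
  shows "\<exists>k D. is_diagram k D \<and> total_rank k D = (\<lambda>J. \<Sum>I\<in>UNIV. real (c I) * schubert_rank I J)"
proof -
  obtain es :: "'n set list" where es: "set es = UNIV" "distinct es"
    using finite_distinct_list[of "UNIV :: 'n set set"] by auto
  define xs where "xs = concat (map (\<lambda>I. replicate (c I) I) es)"
  \<comment> \<open>Columns are numbered from 1 and list entries from 0.\<close>
  define D where "D = {(i, j). j \<in> {1..length xs} \<and> i \<in> xs ! (j - 1)}"
  have col: "column D j = xs ! (j - 1)" if "j \<in> {1..length xs}" for j
    using that by (auto simp: D_def column_def)
  have "total_rank (length xs) D J = (\<Sum>I\<in>UNIV. real (c I) * schubert_rank I J)" for J
  proof -
    have "total_rank (length xs) D J = (\<Sum>j\<in>{1..length xs}. schubert_rank (xs ! (j - 1)) J)"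
      unfolding total_rank_def by (intro sum.cong) (auto simp: col)
    also have "\<dots> = (\<Sum>j<length xs. schubert_rank (xs ! j) J)"
      by (rule sum.reindex_bij_witness[of _ Suc "\<lambda>j. j - 1"]) auto
    also have "\<dots> = sum_list (map (\<lambda>I. schubert_rank I J) xs)"
      by (simp add: sum_list_sum_nth atLeast0LessThan)
    also have "\<dots> = (\<Sum>I\<in>UNIV. real (c I) * schubert_rank I J)"
      unfolding xs_def sum_list_concat_replicate using es by (simp add: sum_list_distinct_conv_sum_set)
    finally show ?thesis .
  qed
  moreover have "is_diagram (length xs) D" by (auto simp: D_def is_diagram_def)
  ultimately show ?thesis by blast
qed

text \<open>Both \<open>z\<close> and \<open>total_rank\<close> record maxima of the same linear
  functionals, so a Schubitope has \<open>z = total_rank k D\<close>, whose coefficients are column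
  multiplicities. Conversely, a diagram with the prescribed multiplicities has the same halfspace
  description as \<open>P\<close>.\<close>

lemma is_schubitope_iff:
  fixes P :: "(real ^ 'n::{finite,linorder}) set"
  assumes "associated_submodular_function P z"
  shows "is_schubitope P \<longleftrightarrow>
    (\<exists>c :: 'n set \<Rightarrow> nat. z = (\<lambda>J. \<Sum>I\<in>UNIV. real (c I) * schubert_rank I J))"
proof -
  have P: "P = {t. (\<forall>I. (\<Sum>i\<in>I. vec_nth t i) \<le> z I) \<and> (\<Sum>i\<in>UNIV. vec_nth t i) = z UNIV}"
    using assms unfolding associated_submodular_function_def by auto
  show ?thesis
  proof
    assume "is_schubitope P"
    then obtain k D where PD: "P = schubitope k D" by (auto simp: is_schubitope_def)
    have "z = total_rank k D"
      using associated_submodular_attained[OF assms]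
      by (intro total_rank_eqI) (auto simp: PD[symmetric] P)
    hence "z = (\<lambda>J. \<Sum>I\<in>UNIV. real (column_count k D I) * schubert_rank I J)"
      by (simp add: fun_eq_iff total_rank_eq_sum_column_count)
    thus "\<exists>c :: 'n set \<Rightarrow> nat. z = (\<lambda>J. \<Sum>I\<in>UNIV. real (c I) * schubert_rank I J)" by blast
  next
    assume "\<exists>c :: 'n set \<Rightarrow> nat. z = (\<lambda>J. \<Sum>I\<in>UNIV. real (c I) * schubert_rank I J)"
    then obtain c :: "'n set \<Rightarrow> nat" where "z = (\<lambda>J. \<Sum>I\<in>UNIV. real (c I) * schubert_rank I J)" ..
    then obtain k D where kD: "is_diagram k D" "total_rank k D = z"
      using diagram_with_total_rank[of c] by auto
    have "P = schubitope k D" unfolding schubitope_halfspaces kD(2) by (rule P)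
    with kD(1) show "is_schubitope P" unfolding is_schubitope_def by blast
  qed
qed

theorem theorem1p4:
  shows
    "family_basis_of set_fun_scale {I. I \<noteq> {}}
       (schubert_rank :: 'n::{finite,linorder} set \<Rightarrow> 'n set \<Rightarrow> real) {f. f {} = 0}
     \<and> (\<forall>(P :: (real ^ 'n::{finite,linorder}) set) z. associated_submodular_function P z \<longrightarrow>
          (is_schubitope P \<longleftrightarrow>
             (\<exists>c :: 'n set \<Rightarrow> nat. z = (\<lambda>J. \<Sum>I\<in>UNIV. real (c I) * schubert_rank I J))))
     \<and> (\<forall>k (D :: ('n \<times> nat) set) D'. is_diagram k D \<longrightarrow> is_diagram k D' \<longrightarrow>
          (schubitope k D = schubitope k D' \<longleftrightarrow>
             (\<exists>\<sigma>. \<sigma> permutes {1..k} \<and> D = {(i, \<sigma> j) | i j. (i, j) \<in> D'})))"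
  by (intro conjI allI impI schubert_rank_basis is_schubitope_iff column_permutation_iff)

end
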